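(* Let $R\succ0$ on the finite-dimensional space $\mathcal{H}=\bigoplus_\rho\mathcal{H}_\rho$ with sector projections $P_\rho$ and $A_\rho=P_\rho RP_\rho$ (on $\mathcal{H}_\rho$). Let a transform-coding objective charge a complexity cost $c_\rho>0$ for each sector handled by a data-driven Karhunen–Loève block, traded against rate through the Lagrangian $\mathcal{J}(S)=\Delta R(S)+\lambda\sum_{\rho\notin S}c_\rho$, where $S$ is the set of sectors handled by the fixed group transform and $\Delta R(S)$ is the excess coding rate it incurs in the high-resolution transform-coding model. Then $$\Delta R(S)=\tfrac12\Bigl(\sum_{\rho\in S}\log\det A_\rho+\log\det C_{S^c}-\log\det R\Bigr),$$ the multi-information of the partition that separates the sectors in $S$ and keeps the complement $S^c$ together, where $C_{S^c}=P_{S^c}RP_{S^c}$. For $\rho\in S^c$, the marginal cost $\Delta R(S\cup\{\rho\})-\Delta R(S)$ of moving sector $\rho$ from the data-driven complement into $S$ is exactly the mutual information $I(X_\rho;X_{S^c\setminus\rho})$ with the remaining data-driven sectors. Hence, for a current set $S$, moving $\rho$ into $S$ lowers $\mathcal{J}$ if and only if $$I(X_\rho;X_{S^c\setminus\rho})<\lambda c_\rho,$$ with equality leaving $\mathcal{J}$ unchanged.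
   Context: The sectors are the mutually orthogonal isotypic components of a unitary group representation. $P_{S^c}=\sum_{\rho\notin S}P_\rho$; $C_{S^c}$ is regarded as an operator on $\bigoplus_{\rho\notin S}\mathcal{H}_\rho$ (determinant of the empty block is $1$). High-resolution model: an orthonormal transform $U$ has total rate (nats per vector) at fixed distortion equal to $\tfrac12\sum_i\log(URU^\ast)_{ii}$ plus a constant independent of $U$; the excess rate is the difference from the minimum over orthonormal $U$, which is $\tfrac12\log\det R$ (attained by an eigenbasis of $R$). The transform realizing $S$ uses an orthonormal eigenbasis of $A_\rho$ on each sector $\rho\in S$ and an orthonormal eigenbasis of the joint block $C_{S^c}$ on the complement. $X$ is zero-mean Gaussian with covariance $R$, $X_\rho=P_\rho X$, $X_T=(X_\rho)_{\rho\in T}$; entropies follow the real-Gaussian convention $h=\tfrac12\log\det(2\pi e\Sigma)$, mutual information is $I(Y;Z)=h(Y)+h(Z)-h(Y,Z)$ (zero if one is empty), and the multi-information of a partition is the sum of the entropies of its blocks minus $h(X)$. *)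

theory Defs
  imports
    "Jordan_Normal_Form.Determinant"
    "HOL-Algebra.Group"
    "HOL-Probability.Probability"
begin

no_notation Matrix.vec_index (infixl \<open>$\<close> 100)
no_notation Matrix.scalar_prod (infix \<open>\<bullet>\<close> 70)

text \<open>
  The Hilbert space is \<open>complex ^ 'n\<close> with the Hermitian inner product \<open>cinner\<close>. Operators are
  matrices, and \<open>vec.span\<close>, \<open>vec.subspace\<close> are span and subspace over the complex scalars. The
  library's \<open>x \<bullet> y\<close> on this type is the real part of \<open>cinner x y\<close>.
\<close>

definition cinner :: "complex ^ 'n \<Rightarrow> complex ^ 'n \<Rightarrow> complex" where
  "cinner x y = (\<Sum>i\<in>UNIV. cnj (x $ i) * y $ i)"

definition conj_transpose :: "complex ^ 'n ^ 'm \<Rightarrow> complex ^ 'm ^ 'n" where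
  "conj_transpose A = (\<chi> i j. cnj (A $ j $ i))"

definition unitary_mat :: "complex ^ 'n ^ 'n \<Rightarrow> bool" where
  "unitary_mat U \<longleftrightarrow> conj_transpose U ** U = mat 1 \<and> U ** conj_transpose U = mat 1"

definition pos_def :: "complex ^ 'n ^ 'n \<Rightarrow> bool" where
  "pos_def R \<longleftrightarrow> conj_transpose R = R \<and> (\<forall>x. x \<noteq> 0 \<longrightarrow> 0 < Re (cinner x (R *v x)))"

definition orthonormal_basis :: "(complex ^ 'n) set \<Rightarrow> (complex ^ 'n) set \<Rightarrow> bool" where
  "orthonormal_basis W B \<longleftrightarrow> B \<subseteq> W \<and> vec.span B = W \<and>
     (\<forall>x\<in>B. \<forall>y\<in>B. cinner x y = (if x = y then 1 else 0))"

definition orthonormal_eigenbasis ::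
  "(complex ^ 'n) set \<Rightarrow> complex ^ 'n ^ 'n \<Rightarrow> (complex ^ 'n) set \<Rightarrow> bool" where
  "orthonormal_eigenbasis W A B \<longleftrightarrow> orthonormal_basis W B \<and> (\<forall>b\<in>B. \<exists>\<mu>. A *v b = \<mu> *s b)"

definition proj :: "(complex ^ 'n) set \<Rightarrow> complex ^ 'n ^ 'n" where
  "proj W = (THE P. \<forall>x. P *v x \<in> W \<and> (\<forall>w\<in>W. cinner w (x - P *v x) = 0))"

text \<open>
  Determinant of an operator on the subspace \<open>W\<close>: the determinant of its matrix in an orthonormal
  basis of \<open>W\<close>, whose choice is immaterial. For \<open>W = {0}\<close> the matrix is of size 0 and the
  determinant is 1.
\<close>

definition det_on :: "(complex ^ 'n) set \<Rightarrow> complex ^ 'n ^ 'n \<Rightarrow> complex" where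
  "det_on W A =
     (let b = (SOME b. distinct b \<and> orthonormal_basis W (set b))
      in Determinant.det
           (Matrix.mat (length b) (length b) (\<lambda>(i, j). cinner (b ! i) (A *v (b ! j)))))"

definition unitary_rep :: "('g, 'b) monoid_scheme \<Rightarrow> ('g \<Rightarrow> complex ^ 'n ^ 'n) \<Rightarrow> bool" where
  "unitary_rep G V \<longleftrightarrow> Group.group G \<and> (\<forall>g\<in>carrier G. unitary_mat (V g)) \<and>
     (\<forall>g\<in>carrier G. \<forall>h\<in>carrier G. V (g \<otimes>\<^bsub>G\<^esub> h) = V g ** V h)"

definition invariant_subspace ::
  "('g, 'b) monoid_scheme \<Rightarrow> ('g \<Rightarrow> complex ^ 'n ^ 'n) \<Rightarrow> (complex ^ 'n) set \<Rightarrow> bool" where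
  "invariant_subspace G V W \<longleftrightarrow> vec.subspace W \<and> (\<forall>g\<in>carrier G. \<forall>w\<in>W. V g *v w \<in> W)"

definition irreducible_subspace ::
  "('g, 'b) monoid_scheme \<Rightarrow> ('g \<Rightarrow> complex ^ 'n ^ 'n) \<Rightarrow> (complex ^ 'n) set \<Rightarrow> bool" where
  "irreducible_subspace G V W \<longleftrightarrow> invariant_subspace G V W \<and> W \<noteq> {0} \<and>
     (\<forall>W'. invariant_subspace G V W' \<and> W' \<subseteq> W \<longrightarrow> W' = {0} \<or> W' = W)"

text \<open>
  Equivalence of subrepresentations. A linear map between subspaces extends to the whole space, so
  the intertwiner may be given by a square matrix.
\<close>

definition equivalent_subreps ::
  "('g, 'b) monoid_scheme \<Rightarrow> ('g \<Rightarrow> complex ^ 'n ^ 'n) \<Rightarrow>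
    (complex ^ 'n) set \<Rightarrow> (complex ^ 'n) set \<Rightarrow> bool" where
  "equivalent_subreps G V W W' \<longleftrightarrow>
     (\<exists>F :: complex ^ 'n ^ 'n. bij_betw ((*v) F) W W' \<and>
        (\<forall>g\<in>carrier G. \<forall>w\<in>W. F *v (V g *v w) = V g *v (F *v w)))"

definition isotypic_component ::
  "('g, 'b) monoid_scheme \<Rightarrow> ('g \<Rightarrow> complex ^ 'n ^ 'n) \<Rightarrow>
    (complex ^ 'n) set \<Rightarrow> (complex ^ 'n) set" where
  "isotypic_component G V W =
     vec.span (\<Union>{W'. irreducible_subspace G V W' \<and> equivalent_subreps G V W W'})"

text \<open>
  Sectors are indexed by themselves: an index \<open>\<rho>\<close> is the subspace \<open>\<H>\<^sub>\<rho>\<close>.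
\<close>

definition sectors ::
  "('g, 'b) monoid_scheme \<Rightarrow> ('g \<Rightarrow> complex ^ 'n ^ 'n) \<Rightarrow> (complex ^ 'n) set set" where
  "sectors G V = isotypic_component G V ` {W. irreducible_subspace G V W}"

definition joint_space :: "(complex ^ 'n) set set \<Rightarrow> (complex ^ 'n) set" where
  "joint_space T = vec.span (\<Union>T)"

definition joint_proj :: "(complex ^ 'n) set set \<Rightarrow> complex ^ 'n ^ 'n" where
  "joint_proj T = (\<Sum>\<rho>\<in>T. proj \<rho>)"

definition sector_block :: "complex ^ 'n ^ 'n \<Rightarrow> (complex ^ 'n) set \<Rightarrow> complex ^ 'n ^ 'n" where
  "sector_block R \<rho> = proj \<rho> ** R ** proj \<rho>"

definition joint_block :: "complex ^ 'n ^ 'n \<Rightarrow> (complex ^ 'n) set set \<Rightarrow> complex ^ 'n ^ 'n" where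
  "joint_block R T = joint_proj T ** R ** joint_proj T"

text \<open>
  High-resolution rate in nats per vector; \<open>\<kappa>\<close> is the additive constant that does not depend on
  the transform.
\<close>

definition coding_rate :: "real \<Rightarrow> complex ^ 'n ^ 'n \<Rightarrow> complex ^ 'n ^ 'n \<Rightarrow> real" where
  "coding_rate \<kappa> R U = (\<Sum>i\<in>UNIV. ln (Re ((U ** R ** conj_transpose U) $ i $ i))) / 2 + \<kappa>"

definition excess_rate :: "real \<Rightarrow> complex ^ 'n ^ 'n \<Rightarrow> complex ^ 'n ^ 'n \<Rightarrow> real" where
  "excess_rate \<kappa> R U = coding_rate \<kappa> R U - Inf (coding_rate \<kappa> R ` {U'. unitary_mat U'})"

text \<open>
  The \<open>i\<close>-th transform coefficient of \<open>x\<close> is \<open>(U *v x) $ i = cinner u\<^sub>i x\<close>, where \<open>u\<^sub>i\<close> is the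
  \<open>i\<close>-th column of the conjugate transpose. These columns are the basis vectors the transform uses.
\<close>

definition transform_vectors :: "complex ^ 'n ^ 'n \<Rightarrow> (complex ^ 'n) set" where
  "transform_vectors U = range (\<lambda>i. column i (conj_transpose U))"

definition realizes ::
  "('g, 'b) monoid_scheme \<Rightarrow> ('g \<Rightarrow> complex ^ 'n ^ 'n) \<Rightarrow> complex ^ 'n ^ 'n \<Rightarrow>
    (complex ^ 'n) set set \<Rightarrow> complex ^ 'n ^ 'n \<Rightarrow> bool" where
  "realizes G V R S U \<longleftrightarrow> unitary_mat U \<and>
     (\<forall>\<rho>\<in>S. orthonormal_eigenbasis \<rho> (sector_block R \<rho>) (transform_vectors U \<inter> \<rho>)) \<and>
     (let T = sectors G V - S in
        orthonormal_eigenbasis (joint_space T) (joint_block R T)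
          (transform_vectors U \<inter> joint_space T))"

text \<open>
  The description operator makes \<open>Delta_R\<close> meaningful only if a realizing transform exists and all
  of them have the same excess rate.
\<close>

definition Delta_R ::
  "('g, 'b) monoid_scheme \<Rightarrow> ('g \<Rightarrow> complex ^ 'n ^ 'n) \<Rightarrow> real \<Rightarrow> complex ^ 'n ^ 'n \<Rightarrow>
    (complex ^ 'n) set set \<Rightarrow> real" where
  "Delta_R G V \<kappa> R S = (THE d. \<exists>U. realizes G V R S U \<and> d = excess_rate \<kappa> R U)"

definition lagrangian ::
  "('g, 'b) monoid_scheme \<Rightarrow> ('g \<Rightarrow> complex ^ 'n ^ 'n) \<Rightarrow> real \<Rightarrow> complex ^ 'n ^ 'n \<Rightarrow>
    ((complex ^ 'n) set \<Rightarrow> real) \<Rightarrow> real \<Rightarrow> (complex ^ 'n) set set \<Rightarrow> real" where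
  "lagrangian G V \<kappa> R c lam S = Delta_R G V \<kappa> R S + lam * (\<Sum>\<rho>\<in>sectors G V - S. c \<rho>)"

definition covariance :: "'a measure \<Rightarrow> ('a \<Rightarrow> complex ^ 'n) \<Rightarrow> complex ^ 'n ^ 'n" where
  "covariance M Y =
     (let m = (LINT \<omega>|M. Y \<omega>) in
      \<chi> i j. LINT \<omega>|M. (Y \<omega> $ i - m $ i) * cnj (Y \<omega> $ j - m $ j))"

text \<open>
  Gaussian: every real-linear functional is a normal, possibly degenerate, random variable. The
  pseudo-covariance is left free, so both real and circularly symmetric vectors are included.
\<close>

definition gaussian_vector :: "'a measure \<Rightarrow> ('a \<Rightarrow> complex ^ 'n) \<Rightarrow> bool" where
  "gaussian_vector M X \<longleftrightarrow> prob_space M \<and> X \<in> borel_measurable M \<and>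
     (\<forall>v. \<exists>\<mu>. (AE \<omega> in M. v \<bullet> X \<omega> = \<mu>) \<or>
        (\<exists>\<sigma>>0. distributed M lborel (\<lambda>\<omega>. v \<bullet> X \<omega>) (normal_density \<mu> \<sigma>)))"

text \<open>
  Entropy of a Gaussian vector with values in the subspace \<open>W\<close>, in the real-Gaussian convention
  \<open>h = 1/2 log det (2 \<pi> e \<Sigma>)\<close> with \<open>\<Sigma>\<close> the covariance operator on \<open>W\<close>.
\<close>

definition entropy_on :: "'a measure \<Rightarrow> (complex ^ 'n) set \<Rightarrow> ('a \<Rightarrow> complex ^ 'n) \<Rightarrow> real" where
  "entropy_on M W Y = ln (Re (det_on W ((2 * pi * exp 1) *\<^sub>R covariance M Y))) / 2"

text \<open>
  The tuple \<open>X\<^sub>T = (X\<^sub>\<rho>)\<close>, \<open>\<rho> \<in> T\<close>, is represented in the internal direct sum \<open>joint_space T\<close> by the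
  sum of its entries \<open>X\<^sub>\<rho> = proj \<rho> *v X\<close>. For \<open>T = {}\<close> its entropy is \<open>ln 1 / 2 = 0\<close>.
\<close>

definition sector_entropy ::
  "'a measure \<Rightarrow> ('a \<Rightarrow> complex ^ 'n) \<Rightarrow> (complex ^ 'n) set set \<Rightarrow> real" where
  "sector_entropy M X T = entropy_on M (joint_space T) (\<lambda>\<omega>. \<Sum>\<rho>\<in>T. proj \<rho> *v X \<omega>)"

text \<open>
  Mutual information of \<open>X\<^sub>T\<close> and \<open>X\<^sub>T\<^sub>'\<close> for disjoint \<open>T\<close>, \<open>T'\<close>; it is 0 if one of them is empty.
\<close>

definition sector_mutual_information ::
  "'a measure \<Rightarrow> ('a \<Rightarrow> complex ^ 'n) \<Rightarrow>
    (complex ^ 'n) set set \<Rightarrow> (complex ^ 'n) set set \<Rightarrow> real" where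
  "sector_mutual_information M X T T' =
     sector_entropy M X T + sector_entropy M X T' - sector_entropy M X (T \<union> T')"

definition multi_information ::
  "'a measure \<Rightarrow> ('a \<Rightarrow> complex ^ 'n) \<Rightarrow> (complex ^ 'n) set set set \<Rightarrow> real" where
  "multi_information M X \<P> = (\<Sum>T\<in>\<P>. sector_entropy M X T) - entropy_on M UNIV X"

definition separating_partition ::
  "('g, 'b) monoid_scheme \<Rightarrow> ('g \<Rightarrow> complex ^ 'n ^ 'n) \<Rightarrow>
    (complex ^ 'n) set set \<Rightarrow> (complex ^ 'n) set set set" where
  "separating_partition G V S = ((\<lambda>\<rho>. {\<rho>}) ` S \<union> {sectors G V - S}) - {{}}"

end

theory Submission
  imports Defs
begin

text \<open>
  By Schur's lemma the sectors are mutually orthogonal, and they span the space. Every compression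
  of \<open>R\<close> to a subspace has an orthonormal eigenbasis, obtained by maximizing Rayleigh quotients;
  these bases, for the sectors in \<open>S\<close> and for the joint complement, together make up a
  realizing transform. In such a basis the determinant of a compression is the product of the
  diagonal entries \<open>cinner b (R *v b)\<close>, so the rate of the transform is half the sum of the
  log-determinants of the blocks, while Hadamard's inequality identifies the optimal rate as
  \<open>ln (det R) / 2\<close>. Gaussian vectors have second moments, so the covariance of \<open>X\<^sub>T\<close> is the
  compression of \<open>R\<close> to the joint space of \<open>T\<close> and its entropy is half the log-determinant of the
  block plus a multiple of the dimension. Dimensions add up over orthogonal blocks, so these
  multiples cancel in every information quantity.
\<close>

section \<open>Hermitian operators and projections\<close>

text \<open>The hinge is the sum of \<open>ln (Re (cinner b (R *v b)))\<close> over an orthonormal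
  basis. A compression to \<open>W\<close> has the same quadratic form on \<open>W\<close> as
  \<open>R\<close>, so over an eigenbasis of the compression this sum is a log-determinant, while
  half of it over the vectors of a unitary transform is the rate up to the additive constant.
  Splitting a basis along the blocks therefore splits rates and determinants together. The
  definitions by choice and description shape the rest: \<open>proj\<close> and
  \<open>Delta_R\<close> need existence and uniqueness, \<open>det_on\<close> needs independence of
  the basis. Moreover \<open>realizes\<close> intersects \<open>transform_vectors U\<close> with
  each block. That no vector of a realizing transform lies outside all blocks is a count of
  dimensions; that a constructed transform has no surplus vector in a block is orthogonality. The
  group is arbitrary: finitely many sectors come from orthogonality in finite dimension, and
  complete reducibility from unitarity instead of averaging over the group.\<close>

lemma cinner_add_left: "cinner (x + y) z = cinner x z + cinner y z"
  by (simp add: cinner_def algebra_simps sum.distrib)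

lemma cinner_add_right: "cinner x (y + z) = cinner x y + cinner x z"
  by (simp add: cinner_def algebra_simps sum.distrib)

lemma cinner_diff_right: "cinner x (y - z) = cinner x y - cinner x z"
  by (simp add: cinner_def algebra_simps sum_subtractf)

lemma cinner_zero_left [simp]: "cinner 0 x = 0"
  by (simp add: cinner_def)

lemma cinner_zero_right [simp]: "cinner x 0 = 0"
  by (simp add: cinner_def)

lemma cinner_scale_left: "cinner (a *s x) y = cnj a * cinner x y"
  by (simp add: cinner_def sum_distrib_left algebra_simps)

lemma cinner_scale_right: "cinner x (a *s y) = a * cinner x y"
  by (simp add: cinner_def sum_distrib_left algebra_simps)

lemma cinner_sum_left: "cinner (\<Sum>i\<in>I. f i) x = (\<Sum>i\<in>I. cinner (f i) x)"
  by (induction I rule: infinite_finite_induct) (auto simp: cinner_add_left)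

lemma cinner_sum_right: "cinner x (\<Sum>i\<in>I. f i) = (\<Sum>i\<in>I. cinner x (f i))"
  by (induction I rule: infinite_finite_induct) (auto simp: cinner_add_right)

lemma cnj_cinner: "cnj (cinner x y) = cinner y x"
  by (simp add: cinner_def mult.commute)

lemma cinner_eq_0_commute: "cinner x y = 0 \<longleftrightarrow> cinner y x = 0"
  by (metis cnj_cinner complex_cnj_zero_iff)

lemma Re_cinner: "Re (cinner x y) = inner x y"
  by (simp add: cinner_def inner_vec_def inner_complex_def)

lemma cinner_self: "cinner x x = of_real ((norm x)\<^sup>2)"
  by (rule complex_eqI) (simp_all add: Re_cinner power2_norm_eq_inner, simp add: cinner_def)

lemma cinner_self_eq_0_iff [simp]: "cinner x x = 0 \<longleftrightarrow> x = 0"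
  by (simp add: cinner_self)

lemma cinner_self_eq_1_iff: "cinner x x = 1 \<longleftrightarrow> norm x = 1"
proof -
  have "cinner x x = 1 \<longleftrightarrow> (norm x)\<^sup>2 = 1"
    unfolding cinner_self using of_real_eq_1_iff by blast
  then show ?thesis
    by (simp add: power2_eq_1_iff) (smt (verit) norm_ge_zero)
qed

lemma cinner_conj_transpose: "cinner (conj_transpose A *v x) y = cinner x (A *v y)"
  unfolding cinner_def conj_transpose_def matrix_vector_mult_def
  by (simp add: sum_distrib_left sum_distrib_right algebra_simps) (rule sum.swap)

lemma cinner_hermitian:
  "conj_transpose A = A \<Longrightarrow> cinner (A *v x) y = cinner x (A *v y)"
  by (metis cinner_conj_transpose)

lemma conj_transpose_conj_transpose [simp]: "conj_transpose (conj_transpose A) = A"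
  by (simp add: conj_transpose_def vec_eq_iff)

lemma conj_transpose_mult: "conj_transpose (A ** B) = conj_transpose B ** conj_transpose A"
  by (simp add: conj_transpose_def matrix_matrix_mult_def vec_eq_iff mult.commute)

section \<open>Orthogonality to spans and orthonormal sets\<close>

lemma cinner_span_zero:
  assumes "\<And>y. y \<in> B \<Longrightarrow> cinner x y = 0" "z \<in> vec.span B"
  shows "cinner x z = 0"
proof -
  have "vec.subspace {z. cinner x z = 0}"
    by (auto simp: vec.subspace_def cinner_add_right cinner_scale_right)
  then show ?thesis
    using vec.span_minimal[of B "{z. cinner x z = 0}"] assms by auto
qed

lemma cinner_span_span_zero:
  assumes "\<And>x y. x \<in> A \<Longrightarrow> y \<in> B \<Longrightarrow> cinner x y = 0" "x \<in> vec.span A" "y \<in> vec.span B"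
  shows "cinner x y = 0"
proof (rule cinner_span_zero[OF _ assms(3)])
  fix y assume "y \<in> B"
  then have "cinner y x = 0"
    using assms(1) by - (rule cinner_span_zero[OF _ assms(2)], metis cinner_eq_0_commute)
  then show "cinner x y = 0"
    by (simp add: cinner_eq_0_commute)
qed

text \<open>The part of \<open>orthonormal_basis\<close> without the span, for sets that are still
  being enlarged or whose span is determined afterwards.\<close>

definition orthonormal_set :: "(complex ^ 'n) set \<Rightarrow> bool" where
  "orthonormal_set B \<longleftrightarrow> (\<forall>x\<in>B. \<forall>y\<in>B. cinner x y = (if x = y then 1 else 0))"

lemma orthonormal_basis_alt:
  "orthonormal_basis W B \<longleftrightarrow> vec.span B = W \<and> orthonormal_set B"
  unfolding orthonormal_basis_def orthonormal_set_def using vec.span_superset by auto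

text \<open>A member in the span of the others would be orthogonal to itself.\<close>

lemma orthonormal_set_independent:
  assumes "orthonormal_set B"
  shows "vec.independent B"
proof (unfold vec.dependent_def, safe)
  fix a assume a: "a \<in> B" "a \<in> vec.span (B - {a})"
  then have "cinner a a = 0"
    using assms by - (rule cinner_span_zero[of "B - {a}"], auto simp: orthonormal_set_def)
  moreover have "cinner a a = 1"
    using a assms by (auto simp: orthonormal_set_def)
  ultimately show False
    by simp
qed

lemma orthonormal_set_finite: "orthonormal_set B \<Longrightarrow> finite B"
  using orthonormal_set_independent vec.finiteI_independent by blast

lemma orthonormal_basis_finite: "orthonormal_basis W B \<Longrightarrow> finite B"
  by (simp add: orthonormal_basis_alt orthonormal_set_finite)

lemma orthonormal_basis_card: "orthonormal_basis W B \<Longrightarrow> card B = vec.dim W"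
  by (metis orthonormal_basis_alt orthonormal_set_independent vec.dim_span_eq_card_independent)

lemma orthonormal_basis_in: "orthonormal_basis W B \<Longrightarrow> b \<in> B \<Longrightarrow> b \<in> W"
  by (auto simp: orthonormal_basis_def)

lemma orthonormal_basis_cinner:
  "orthonormal_basis W B \<Longrightarrow> b \<in> B \<Longrightarrow> b' \<in> B \<Longrightarrow> cinner b b' = (if b = b' then 1 else 0)"
  by (auto simp: orthonormal_basis_def)

lemma orthonormal_basis_subspace: "orthonormal_basis W B \<Longrightarrow> vec.subspace W"
  using vec.subspace_span by (auto simp: orthonormal_basis_alt)

text \<open>The Gram-Schmidt step. It yields the expansion in a basis and, for a set that does not
  span, a direction in which to enlarge it.\<close>

lemma orthonormal_residual:
  assumes "orthonormal_set B" "b \<in> B"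
  shows "cinner b (x - (\<Sum>c\<in>B. cinner c x *s c)) = 0"
proof -
  have "cinner b (\<Sum>c\<in>B. cinner c x *s c) = (\<Sum>c\<in>B. if b = c then cinner c x else 0)"
    unfolding cinner_sum_right
    by (rule sum.cong) (use assms in \<open>auto simp: cinner_scale_right orthonormal_set_def\<close>)
  also have "\<dots> = cinner b x"
    using assms orthonormal_set_finite[OF assms(1)] by simp
  finally show ?thesis
    by (simp add: cinner_diff_right)
qed

lemma orthonormal_basis_expand:
  assumes "orthonormal_basis W B" "x \<in> W"
  shows "x = (\<Sum>b\<in>B. cinner b x *s b)"
proof -
  let ?r = "x - (\<Sum>b\<in>B. cinner b x *s b)"
  have B: "vec.span B = W" "orthonormal_set B"
    using assms by (auto simp: orthonormal_basis_alt)
  have "?r \<in> vec.span B"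
    by (intro vec.span_diff vec.span_sum vec.span_scale) (use assms B in \<open>auto intro: vec.span_base\<close>)
  moreover have "cinner ?r b = 0" if "b \<in> B" for b
    using orthonormal_residual[OF B(2) that] by (subst cinner_eq_0_commute) 
  ultimately have "cinner ?r ?r = 0"
    by - (rule cinner_span_zero[of B], auto)
  then show ?thesis
    by simp
qed

text \<open>Parseval's identity, used as insertion of a resolution of the identity in changes of
  basis.\<close>

lemma orthonormal_basis_cinner_expand:
  assumes "orthonormal_basis W B" "x \<in> W"
  shows "cinner x y = (\<Sum>b\<in>B. cinner x b * cinner b y)"
proof -
  have "cinner x y = cinner (\<Sum>b\<in>B. cinner b x *s b) y"
    using orthonormal_basis_expand[OF assms] by simp
  then show ?thesis
    by (simp add: cinner_sum_left cinner_scale_left cnj_cinner)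
qed

section \<open>Real scalars and the spectral theorem\<close>

lemma scaleR_eq_vector_scale: "a *\<^sub>R x = complex_of_real a *s x"
  by (simp add: vec_eq_iff) (simp add: scaleR_conv_of_real)

lemma matrix_vector_scaleR: "A *v (a *\<^sub>R x) = a *\<^sub>R (A *v x)"
  for A :: "complex ^ 'n ^ 'm"
  by (simp add: scaleR_eq_vector_scale vec.scale)

text \<open>Closedness of subspaces, needed for the compactness argument, is a statement about real
  subspaces.\<close>

lemma subspace_if_vec_subspace:
  fixes W :: "(complex ^ 'n) set"
  shows "vec.subspace W \<Longrightarrow> subspace W"
  by (simp add: vec.subspace_def subspace_def scaleR_eq_vector_scale)

lemma normalized_in_subspace:
  fixes W :: "(complex ^ 'n) set"
  assumes "vec.subspace W" "y \<in> W" "y \<noteq> 0"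
  shows "y /\<^sub>R norm y \<in> W" "norm (y /\<^sub>R norm y) = 1"
  using assms subspace_scale[OF subspace_if_vec_subspace] by auto

text \<open>
  A maximizer of the Rayleigh quotient is an eigenvector: otherwise moving it along its residual
  increases the quotient.
\<close>

lemma hermitian_eigenvector:
  fixes A :: "complex ^ 'n ^ 'n"
  assumes A: "conj_transpose A = A" and W: "vec.subspace W" "W \<noteq> {0}"
    and inv: "\<And>w. w \<in> W \<Longrightarrow> A *v w \<in> W"
  obtains x \<mu> where "x \<in> W" "cinner x x = 1" "A *v x = complex_of_real \<mu> *s x"
proof -
  define q where "q x = inner x (A *v x)" for x
  have "closed W"
    using W closed_subspace subspace_if_vec_subspace by blast
  then have "compact (sphere 0 1 \<inter> W)"
    by (intro compact_Int_closed) auto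
  moreover obtain y where y: "y \<in> W" "y \<noteq> 0"
    using W vec.subspace_0 by blast
  then have "y /\<^sub>R norm y \<in> sphere 0 1 \<inter> W"
    using normalized_in_subspace[OF W(1) y] by simp
  moreover have "continuous_on (sphere 0 1 \<inter> W) q"
    unfolding q_def Re_cinner[symmetric] cinner_def matrix_vector_mult_def
    by (simp del: Re_sum Im_sum) (intro continuous_intros)
  ultimately obtain x where x: "x \<in> W" "norm x = 1"
    and max: "\<And>z. norm z = 1 \<Longrightarrow> z \<in> W \<Longrightarrow> q z \<le> q x"
    using continuous_attains_sup[of "sphere 0 1 \<inter> W" q] by fastforce
  define m where "m = q x"
  have q_le: "q z \<le> m * (norm z)\<^sup>2" if z: "z \<in> W" for z
  proof (cases "z = 0")
    case False
    have "q (z /\<^sub>R norm z) \<le> m"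
      unfolding m_def using normalized_in_subspace[OF W(1) z False] max by blast
    also have "q (z /\<^sub>R norm z) = q z / (norm z)\<^sup>2"
      by (simp add: q_def matrix_vector_scaleR divide_simps power2_eq_square)
    finally show ?thesis
      using False by (simp add: divide_simps mult.commute)
  qed (simp add: q_def)
  \<comment> \<open>The negative of the usual residual; the linear term of the quadratic in
    \<open>t\<close> below then has the positive coefficient
    \<open>2 * (norm r)\<^sup>2\<close>.\<close>
  define r where "r = m *\<^sub>R x - A *v x"
  have r: "r \<in> W"
    unfolding r_def using x inv W by (intro vec.subspace_diff) (auto simp: scaleR_eq_vector_scale vec.subspace_scale)
  define C where "C = m * (norm r)\<^sup>2 - q r"
  have C: "0 \<le> C"
    using q_le[OF r] by (simp add: C_def)
  have herm: "inner x (A *v r) = inner r (A *v x)"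
    by (metis A Re_cinner cinner_hermitian inner_commute)
  \<comment> \<open>This is \<open>q z \<le> m * (norm z)\<^sup>2\<close> at
    \<open>z = x + t *\<^sub>R r\<close>: the constant terms cancel because \<open>x\<close> is a
    maximizer of norm 1.\<close>
  have quad: "0 \<le> 2 * t * (norm r)\<^sup>2 + t\<^sup>2 * C" for t :: real
  proof -
    have "x + t *\<^sub>R r \<in> W"
      using x r W by (simp add: scaleR_eq_vector_scale vec.subspace_add vec.subspace_scale)
    from q_le[OF this] have "0 \<le> m * (norm (x + t *\<^sub>R r))\<^sup>2 - q (x + t *\<^sub>R r)"
      by simp
    also have "A *v (x + t *\<^sub>R r) = A *v x + t *\<^sub>R (A *v r)"
      by (simp add: matrix_vector_scaleR vec.add)
    then have "q (x + t *\<^sub>R r) = m + 2 * t * inner r (A *v x) + t\<^sup>2 * q r"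
      unfolding q_def m_def by (simp add: inner_add_left inner_add_right herm algebra_simps power2_eq_square)
    also have "(norm (x + t *\<^sub>R r))\<^sup>2 = 1 + 2 * t * inner r x + t\<^sup>2 * (norm r)\<^sup>2"
      unfolding power2_norm_eq_inner using x
      by (simp add: norm_eq_1 inner_add_left inner_add_right inner_commute algebra_simps power2_eq_square)
    finally have "0 \<le> 2 * t * (m * inner r x - inner r (A *v x)) + t\<^sup>2 * C"
      by (simp add: C_def algebra_simps)
    also have "m * inner r x - inner r (A *v x) = (norm r)\<^sup>2"
      by (subst (3) r_def) (simp add: power2_norm_eq_inner inner_diff_right r_def)
    finally show ?thesis .
  qed
  have "r = 0"
  proof (rule ccontr)
    assume "r \<noteq> 0"
    then have a: "0 < (norm r)\<^sup>2"
      by simp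
    \<comment> \<open>A small negative \<open>t\<close> violates \<open>quad\<close>. The
      denominator is \<open>C + 1\<close> rather than \<open>C\<close> since \<open>C\<close> may be
      0.\<close>
    have "2 * t * a + t\<^sup>2 * C < 0" if "t = - a / (C + 1)" "0 < a" for t a :: real
    proof -
      have "2 * t * a + t\<^sup>2 * C = - (a\<^sup>2 * (C + 2) / (C + 1)\<^sup>2)"
        using C by (simp add: that(1) divide_simps) (simp add: algebra_simps power2_eq_square)
      also have "\<dots> < 0"
        using C that(2) by simp
      finally show ?thesis .
    qed
    from this[OF refl a] quad show False
      by (meson not_less)
  qed
  then have "A *v x = complex_of_real m *s x"
    by (simp add: r_def scaleR_eq_vector_scale)
  then show thesis
    using that x by (simp add: cinner_self_eq_1_iff)
qed

text \<open>Take an orthonormal set of eigenvectors in \<open>W\<close> of largest cardinality. Its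
  orthogonal complement in \<open>W\<close> is again invariant because \<open>A\<close> is
  Hermitian, so if nonzero it would supply one more eigenvector.\<close>

lemma hermitian_orthonormal_eigenbasis:
  fixes A :: "complex ^ 'n ^ 'n"
  assumes A: "conj_transpose A = A" and W: "vec.subspace W"
    and inv: "\<And>w. w \<in> W \<Longrightarrow> A *v w \<in> W"
  obtains B where "orthonormal_eigenbasis W A B"
proof -
  define Q where "Q B \<longleftrightarrow> B \<subseteq> W \<and> orthonormal_set B \<and> (\<forall>b\<in>B. \<exists>\<mu>. A *v b = \<mu> *s b)" for B
  have "Q {}"
    by (simp add: Q_def orthonormal_set_def)
  moreover have "\<forall>B. Q B \<longrightarrow> card B < Suc (vec.dim W)"
    unfolding less_Suc_eq_le using vec.independent_card_le_dim orthonormal_set_independent unfolding Q_def by blast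
  ultimately have "\<exists>B. Q B \<and> (\<forall>B'. Q B' \<longrightarrow> card B' \<le> card B)"
    by (intro ex_has_greatest_nat)
  then obtain B where B: "Q B" and max: "\<And>B'. Q B' \<Longrightarrow> card B' \<le> card B"
    by blast
  have "vec.span B = W"
  proof (rule ccontr)
    assume ne: "vec.span B \<noteq> W"
    have sub: "vec.span B \<subseteq> W"
      using B W by (simp add: Q_def vec.span_minimal)
    then obtain w where w: "w \<in> W" "w \<notin> vec.span B"
      using ne by blast
    let ?W = "{w \<in> W. \<forall>b\<in>B. cinner b w = 0}"
    let ?p = "\<Sum>c\<in>B. cinner c w *s c"
    have p: "?p \<in> vec.span B"
      by (intro vec.span_sum vec.span_scale) (rule vec.span_base)
    then have "w - ?p \<in> ?W"
      using orthonormal_residual[of B _ w] B w sub W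
      by (auto simp: Q_def intro: vec.subspace_diff)
    moreover have "w - ?p \<noteq> 0"
      using p w by auto
    ultimately have ne0: "?W \<noteq> {0}"
      by blast
    have subW: "vec.subspace ?W"
      using W by (auto simp: vec.subspace_def cinner_add_right cinner_scale_right)
    have inW: "A *v v \<in> ?W" if "v \<in> ?W" for v
    proof -
      have "cinner b (A *v v) = 0" if b: "b \<in> B" for b
      proof -
        obtain \<mu> where "A *v b = \<mu> *s b"
          using B b by (auto simp: Q_def)
        then show ?thesis
          using \<open>v \<in> ?W\<close> b
          by (simp add: cinner_scale_left flip: cinner_hermitian[OF A])
      qed
      then show ?thesis
        using that inv by auto
    qed
    obtain x \<mu> where x: "x \<in> ?W" "cinner x x = 1" "A *v x = complex_of_real \<mu> *s x"
      by (rule hermitian_eigenvector[OF A subW ne0 inW])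
    have "x \<notin> B"
      using x by auto
    have "Q (insert x B)"
      using B x \<open>x \<notin> B\<close> by (auto simp: Q_def orthonormal_set_def) (metis cinner_eq_0_commute)
    then have "card (insert x B) \<le> card B"
      by (rule max)
    then show False
      using \<open>x \<notin> B\<close> B orthonormal_set_finite[of B] by (auto simp: Q_def)
  qed
  then have "orthonormal_eigenbasis W A B"
    using B by (simp add: orthonormal_eigenbasis_def orthonormal_basis_alt Q_def)
  then show thesis
    by (rule that)
qed

section \<open>Orthonormal bases of subspaces and orthogonal projections\<close>

lemma orthonormal_basis_exists:
  fixes W :: "(complex ^ 'n) set"
  assumes "vec.subspace W"
  obtains B where "orthonormal_basis W B"
proof -
  \<comment> \<open>Existence of a basis is the spectral theorem for the zero operator.\<close>
  have "conj_transpose (0 :: complex ^ 'n ^ 'n) = 0"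
    by (simp add: conj_transpose_def vec_eq_iff)
  then obtain B where "orthonormal_eigenbasis W (0 :: complex ^ 'n ^ 'n) B"
    using hermitian_orthonormal_eigenbasis[of 0 W] assms
    by (metis matrix_vector_mult_0 vec.subspace_0)
  then show thesis
    using that by (auto simp: orthonormal_eigenbasis_def)
qed

text \<open>Justifies the description operator in \<open>proj\<close>. Two candidates differ by a
  vector that lies in \<open>W\<close> and is orthogonal to \<open>W\<close>, hence by 0.\<close>

lemma proj_characterization:
  fixes W :: "(complex ^ 'n) set"
  assumes W: "vec.subspace W"
  shows "proj W *v x \<in> W \<and> (\<forall>w\<in>W. cinner w (x - proj W *v x) = 0)"
proof -
  obtain B where B: "orthonormal_basis W B"
    using orthonormal_basis_exists[OF W] .
  have B': "vec.span B = W" "orthonormal_set B"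
    using B by (auto simp: orthonormal_basis_alt)
  \<comment> \<open>The sum of the rank-one projections onto the vectors of an orthonormal
    basis.\<close>
  define P :: "complex ^ 'n ^ 'n" where "P = (\<chi> i j. \<Sum>b\<in>B. b $ i * cnj (b $ j))"
  have P_eq: "P *v x = (\<Sum>b\<in>B. cinner b x *s b)" for x
  proof -
    have "(P *v x) $ i = (\<Sum>b\<in>B. cinner b x *s b) $ i" for i
    proof -
      have "(P *v x) $ i = (\<Sum>j\<in>UNIV. \<Sum>b\<in>B. b $ i * cnj (b $ j) * x $ j)"
        by (simp add: P_def matrix_vector_mult_def sum_distrib_right)
      also have "\<dots> = (\<Sum>b\<in>B. \<Sum>j\<in>UNIV. b $ i * cnj (b $ j) * x $ j)"
        by (rule sum.swap)
      also have "\<dots> = (\<Sum>b\<in>B. cinner b x *s b) $ i"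
        by (simp add: cinner_def sum_distrib_left algebra_simps)
      finally show ?thesis .
    qed
    then show ?thesis
      by (simp add: vec_eq_iff)
  qed
  let ?Q = "\<lambda>P :: complex ^ 'n ^ 'n. \<forall>x. P *v x \<in> W \<and> (\<forall>w\<in>W. cinner w (x - P *v x) = 0)"
  have "?Q P"
  proof safe
    fix x
    show "P *v x \<in> W"
      unfolding P_eq B'(1)[symmetric] by (intro vec.span_sum vec.span_scale) (auto intro: vec.span_base)
    fix w assume "w \<in> W"
    then have "cinner (x - P *v x) w = 0"
      using orthonormal_residual[OF B'(2), of _ x] B'(1)
      by - (rule cinner_span_zero[of B], auto simp: P_eq cinner_eq_0_commute[of "_ - _"])
    then show "cinner w (x - P *v x) = 0"
      by (simp add: cinner_eq_0_commute)
  qed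
  moreover have "P' = P''" if P: "?Q P'" "?Q P''" for P' P''
  proof -
    have "P' *v x = P'' *v x" for x
    proof -
      let ?d = "P' *v x - P'' *v x"
      have d: "?d \<in> W"
        using P W by (simp add: vec.subspace_diff)
      have "cinner ?d ?d = cinner ?d ((x - P'' *v x) - (x - P' *v x))"
        by simp
      also have "\<dots> = 0"
        unfolding cinner_diff_right[of _ "x - P'' *v x"] using P d by simp
      finally show ?thesis
        by simp
    qed
    then show ?thesis
      by (simp add: matrix_eq)
  qed
  ultimately have "?Q (proj W)"
    unfolding proj_def by (intro theI[of ?Q P])
  then show ?thesis
    by blast
qed

lemma proj_in: "vec.subspace W \<Longrightarrow> proj W *v x \<in> W"
  using proj_characterization by blast

lemma proj_residual: "vec.subspace W \<Longrightarrow> w \<in> W \<Longrightarrow> cinner w (x - proj W *v x) = 0"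
  using proj_characterization by blast

lemma proj_unique:
  assumes W: "vec.subspace W" and y: "y \<in> W" "\<And>w. w \<in> W \<Longrightarrow> cinner w (x - y) = 0"
  shows "proj W *v x = y"
proof -
  let ?d = "proj W *v x - y"
  have d: "?d \<in> W"
    using W y(1) proj_in[OF W] by (simp add: vec.subspace_diff)
  have "cinner ?d ?d = cinner ?d ((x - y) - (x - proj W *v x))"
    by simp
  also have "\<dots> = 0"
    unfolding cinner_diff_right[of _ "x - y"] using y(2)[OF d] proj_residual[OF W d] by simp
  finally show ?thesis
    by simp
qed

lemma proj_id: "vec.subspace W \<Longrightarrow> w \<in> W \<Longrightarrow> proj W *v w = w"
  by (rule proj_unique) auto

lemma cinner_proj_right: "vec.subspace W \<Longrightarrow> w \<in> W \<Longrightarrow> cinner w (proj W *v x) = cinner w x"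
  using proj_residual[of W w x] by (simp add: cinner_diff_right)

lemma proj_hermitian:
  assumes W: "vec.subspace W"
  shows "conj_transpose (proj W) = proj W"
proof -
  have "cinner z (conj_transpose (proj W) *v x - proj W *v x) = 0" for x z
  proof -
    have "cinner z (conj_transpose (proj W) *v x) = cinner (proj W *v z) x"
      using cinner_conj_transpose[of "conj_transpose (proj W)" z x] by simp
    also have "\<dots> = cinner (proj W *v z) (proj W *v x)"
      using W by (simp add: cinner_proj_right proj_in)
    also have "\<dots> = cinner z (proj W *v x)"
      using cinner_proj_right[OF W proj_in[OF W], of x z] by (metis cnj_cinner)
    finally show ?thesis
      by (simp add: cinner_diff_right)
  qed
  then have "conj_transpose (proj W) *v x = proj W *v x" for x
    using cinner_self_eq_0_iff[of "conj_transpose (proj W) *v x - proj W *v x"] by simp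
  then show ?thesis
    by (simp add: matrix_eq)
qed

section \<open>Determinants on subspaces and the optimal rate\<close>

lemma sum_nth_distinct: "distinct xs \<Longrightarrow> (\<Sum>k = 0..<length xs. f (xs ! k)) = sum f (set xs)"
  by (rule sum.reindex_bij_betw) (simp add: bij_betw_nth lessThan_atLeast0)

text \<open>The matrices in two orthonormal bases are related by \<open>Q\<close> and
  \<open>Q'\<close>, which are inverse to each other, so their determinants cancel. No invariance of
  \<open>W\<close> under \<open>A\<close> enters: a matrix entry pairs vectors of \<open>W\<close>
  only, and these are what is expanded.\<close>

lemma det_on_eq:
  assumes b: "distinct b" "orthonormal_basis W (set b)"
  shows "det_on W A =
    Determinant.det (Matrix.mat (length b) (length b) (\<lambda>(i, j). cinner (b ! i) (A *v (b ! j))))"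
proof -
  define b0 where "b0 = (SOME b. distinct b \<and> orthonormal_basis W (set b))"
  have b0: "distinct b0" "orthonormal_basis W (set b0)"
    using someI[of "\<lambda>b. distinct b \<and> orthonormal_basis W (set b)" b] b
    by (auto simp: b0_def)
  define n where "n = length b"
  have n: "length b = n" "length b0 = n"
    using distinct_card[OF b(1)] distinct_card[OF b0(1)]
      orthonormal_basis_card[OF b(2)] orthonormal_basis_card[OF b0(2)]
    by (simp_all add: n_def)
  define M where "M c = Matrix.mat n n (\<lambda>(i, j). cinner (c ! i) (A *v (c ! j)))" for c
  define Q where "Q = Matrix.mat n n (\<lambda>(i, j). cinner (b0 ! i) (b ! j))"
  define Q' where "Q' = Matrix.mat n n (\<lambda>(i, j). cinner (b ! i) (b0 ! j))"
  have dims: "Q \<in> carrier_mat n n" "Q' \<in> carrier_mat n n" "M c \<in> carrier_mat n n" for c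
    by (auto simp: Q_def Q'_def M_def)
  have bW: "b ! i \<in> W" if "i < n" for i
    using that n orthonormal_basis_in[OF b(2), of "b ! i"] by simp
  have expand: "(\<Sum>k = 0..<n. cinner x (b0 ! k) * cinner (b0 ! k) y) = cinner x y"
    if "x \<in> W" for x y
    using sum_nth_distinct[OF b0(1), of "\<lambda>c. cinner x c * cinner c y"] n
    by (simp add: orthonormal_basis_cinner_expand[OF b0(2) that, symmetric])
  have expand': "(\<Sum>k = 0..<n. cinner x (b0 ! k) * cinner (b0 ! k) y) = cinner x y"
    if "y \<in> W" for x y
  proof -
    have "cnj (\<Sum>k = 0..<n. cinner y (b0 ! k) * cinner (b0 ! k) x) = cnj (cinner y x)"
      using expand[OF that] by simp
    then show ?thesis
      by (simp add: cnj_cinner mult.commute)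
  qed
  have "Q' * Q = 1\<^sub>m n"
    by (rule eq_matI)
      (use b n bW in \<open>auto simp: Q_def Q'_def scalar_prod_def expand nth_eq_iff_index_eq
        orthonormal_basis_cinner[OF b(2)]\<close>)
  moreover have "Q' * (M b0 * Q) = M b"
  proof (rule eq_matI)
    fix i j assume "i < dim_row (M b)" "j < dim_col (M b)"
    then have ij: "i < n" "j < n"
      by (auto simp: M_def)
    have "(Q' * (M b0 * Q)) $$ (i, j) =
      (\<Sum>k = 0..<n. cinner (b ! i) (b0 ! k) *
         (\<Sum>l = 0..<n. cinner (b0 ! k) (A *v (b0 ! l)) * cinner (b0 ! l) (b ! j)))"
      using ij by (simp add: Q_def Q'_def M_def scalar_prod_def)
    also have "\<dots> = (\<Sum>k = 0..<n. cinner (b ! i) (b0 ! k) * cinner (b0 ! k) (A *v (b ! j)))"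
      \<comment> \<open>Moving \<open>A\<close> into the left argument leaves the plain vector
        \<open>b ! j\<close>, which lies in \<open>W\<close>, to be expanded.\<close>
      using expand'[OF bW[OF ij(2)]]
      by (simp flip: cinner_conj_transpose)
    also have "\<dots> = M b $$ (i, j)"
      using expand[OF bW[OF ij(1)]] ij by (simp add: M_def)
    finally show "(Q' * (M b0 * Q)) $$ (i, j) = M b $$ (i, j)" .
  qed (auto simp: Q_def Q'_def M_def)
  ultimately have "Determinant.det (M b) = Determinant.det (M b0)"
    using dims det_mult[of Q' n "M b0 * Q"] det_mult[of "M b0" n Q] det_mult[of Q' n Q]
    by (metis det_one mult.commute mult.left_commute mult.right_neutral mult_carrier_mat)
  then show ?thesis
    unfolding det_on_def Let_def b0_def[symmetric] M_def n by simp
qed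

section \<open>Determinants in eigenbases and compressions\<close>

lemma eigenbasis_eigenvector:
  assumes B: "orthonormal_eigenbasis W A B" and b: "b \<in> B"
  shows "A *v b = cinner b (A *v b) *s b"
proof -
  obtain \<mu> where "A *v b = \<mu> *s b"
    using assms by (auto simp: orthonormal_eigenbasis_def)
  moreover have "cinner b b = 1"
    using assms by (simp add: orthonormal_eigenbasis_def orthonormal_basis_def)
  ultimately show ?thesis
    by (simp add: cinner_scale_right)
qed

lemma eigenbasis_off_diagonal:
  assumes B: "orthonormal_eigenbasis W A B" and b: "b \<in> B" "b' \<in> B" "b \<noteq> b'"
  shows "cinner b (A *v b') = 0"
  using assms
  by (subst eigenbasis_eigenvector[OF B b(2)])
    (auto simp: cinner_scale_right orthonormal_eigenbasis_def orthonormal_basis_def)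

lemma det_on_eigenbasis:
  assumes B: "orthonormal_eigenbasis W A B"
  shows "det_on W A = (\<Prod>b\<in>B. cinner b (A *v b))"
proof -
  have onb: "orthonormal_basis W B"
    using B by (simp add: orthonormal_eigenbasis_def)
  obtain b where b: "set b = B" "distinct b"
    using finite_distinct_list[OF orthonormal_basis_finite[OF onb]] by blast
  define M where "M = Matrix.mat (length b) (length b) (\<lambda>(i, j). cinner (b ! i) (A *v (b ! j)))"
  have "det_on W A = Determinant.det M"
    unfolding M_def using det_on_eq b onb by blast
  also have "\<dots> = prod_list (diag_mat M)"
    using b by (intro det_upper_triangular[of _ "length b"])
      (auto simp: M_def upper_triangular_def nth_eq_iff_index_eq intro!: eigenbasis_off_diagonal[OF B])
  also have "diag_mat M = map (\<lambda>c. cinner c (A *v c)) b"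
    by (rule nth_equalityI) (auto simp: diag_mat_def M_def)
  also have "prod_list \<dots> = (\<Prod>b\<in>B. cinner b (A *v b))"
    using prod.distinct_set_conv_list[OF b(2), of "\<lambda>c. cinner c (A *v c)"] b(1) by simp
  finally show ?thesis .
qed

text \<open>Common form of \<open>sector_block\<close>, \<open>joint_block\<close> and, for
  \<open>W = UNIV\<close>, of \<open>R\<close> itself, indexed by a subspace so that all blocks are
  treated alike.\<close>

definition compression :: "complex ^ 'n ^ 'n \<Rightarrow> (complex ^ 'n) set \<Rightarrow> complex ^ 'n ^ 'n" where
  "compression R W = proj W ** R ** proj W"

lemma compression_in: "vec.subspace W \<Longrightarrow> compression R W *v x \<in> W"
  by (simp add: compression_def proj_in flip: matrix_vector_mul_assoc)

lemma compression_hermitian: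
  "vec.subspace W \<Longrightarrow> conj_transpose R = R \<Longrightarrow> conj_transpose (compression R W) = compression R W"
  by (simp add: compression_def conj_transpose_mult proj_hermitian matrix_mul_assoc)

text \<open>Lets the diagonal entries of every block be written with \<open>R\<close>, independently
  of the block to which a basis vector belongs.\<close>

lemma cinner_compression:
  "vec.subspace W \<Longrightarrow> x \<in> W \<Longrightarrow> y \<in> W \<Longrightarrow> cinner x (compression R W *v y) = cinner x (R *v y)"
  by (simp add: compression_def proj_id cinner_proj_right flip: matrix_vector_mul_assoc)

lemma proj_UNIV: "proj UNIV = mat 1"
  by (simp add: matrix_eq proj_id)

lemma compression_UNIV: "compression R UNIV = R"
  by (simp add: compression_def proj_UNIV)

lemma pos_def_hermitian: "pos_def R \<Longrightarrow> conj_transpose R = R"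
  by (simp add: pos_def_def)

lemma pos_def_cinner_eq:
  assumes "pos_def R"
  shows "cinner x (R *v x) = of_real (Re (cinner x (R *v x)))"
proof -
  have "cnj (cinner x (R *v x)) = cinner x (R *v x)"
    unfolding cnj_cinner using assms by (simp add: pos_def_def cinner_hermitian)
  then show ?thesis
    by (metis Reals_cnj_iff of_real_Re)
qed

lemma pos_def_cinner_pos: "pos_def R \<Longrightarrow> cinner x x = 1 \<Longrightarrow> 0 < Re (cinner x (R *v x))"
  unfolding pos_def_def using cinner_zero_left zero_neq_one by metis

lemma compression_eigenbasis_exists:
  assumes "pos_def R" "vec.subspace W"
  obtains B where "orthonormal_eigenbasis W (compression R W) B"
  using hermitian_orthonormal_eigenbasis[of "compression R W" W] assms
    compression_hermitian compression_in pos_def_hermitian by metis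

text \<open>Scaling keeps the eigenvectors, and each of the \<open>vec.dim W\<close> diagonal
  entries gains the factor \<open>c\<close>. The value \<open>c = 1\<close> serves the rate,
  \<open>c = 2 * pi * exp 1\<close> the entropy.\<close>

lemma ln_det_on_compression:
  assumes R: "pos_def R" and B: "orthonormal_eigenbasis W (compression R W) B" and c: "0 < c"
  shows "ln (Re (det_on W (c *\<^sub>R compression R W))) =
    (\<Sum>b\<in>B. ln (Re (cinner b (R *v b)))) + vec.dim W * ln c"
proof -
  have onb: "orthonormal_basis W B"
    using B by (simp add: orthonormal_eigenbasis_def)
  have "(c *\<^sub>R compression R W) *v x = c *\<^sub>R (compression R W *v x)" for x
    by (simp add: vec_eq_iff matrix_vector_mult_def scaleR_sum_right)
  then have scale: "(c *\<^sub>R compression R W) *v x = complex_of_real c *s (compression R W *v x)" for x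
    by (simp flip: scaleR_eq_vector_scale)
  have "orthonormal_eigenbasis W (c *\<^sub>R compression R W) B"
    using B unfolding orthonormal_eigenbasis_def scale by (metis vec.scale_scale)
  then have "det_on W (c *\<^sub>R compression R W) =
      (\<Prod>b\<in>B. cinner b ((c *\<^sub>R compression R W) *v b))"
    by (rule det_on_eigenbasis)
  also have "\<dots> = (\<Prod>b\<in>B. complex_of_real (c * Re (cinner b (R *v b))))"
    using orthonormal_basis_in[OF onb] orthonormal_basis_subspace[OF onb]
    by (intro prod.cong)
      (auto simp: scale cinner_scale_right cinner_compression simp flip: pos_def_cinner_eq[OF R])
  also have "\<dots> = complex_of_real (\<Prod>b\<in>B. c * Re (cinner b (R *v b)))"
    by simp
  finally have "Re (det_on W (c *\<^sub>R compression R W)) = (\<Prod>b\<in>B. c * Re (cinner b (R *v b)))"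
    using Re_complex_of_real by metis
  then have "ln (Re (det_on W (c *\<^sub>R compression R W))) = ln (\<Prod>b\<in>B. c * Re (cinner b (R *v b)))"
    by simp
  \<comment> \<open>Basis vectors have norm 1, so each factor is positive and the logarithm of the
    product splits.\<close>
  also have pos: "0 < Re (cinner b (R *v b))" if "b \<in> B" for b
    using pos_def_cinner_pos[OF R] orthonormal_basis_cinner[OF onb that that] by simp
  then have "ln (\<Prod>b\<in>B. c * Re (cinner b (R *v b))) = (\<Sum>b\<in>B. ln (c * Re (cinner b (R *v b))))"
    using c by (intro ln_prod orthonormal_basis_finite[OF onb]) (metis less_irrefl mult_pos_pos)
  also have "\<dots> = (\<Sum>b\<in>B. ln (Re (cinner b (R *v b))) + ln c)"
    using c by (intro sum.cong) (use less_imp_neq[OF pos] in \<open>auto simp: ln_mult\<close>)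
  also have "\<dots> = (\<Sum>b\<in>B. ln (Re (cinner b (R *v b)))) + vec.dim W * ln c"
    using onb by (simp add: sum.distrib orthonormal_basis_card)
  finally show ?thesis .
qed

section \<open>Unitary transforms as orthonormal bases\<close>

lemma transform_entry:
  "(U ** A ** conj_transpose U) $ i $ j =
     cinner (column i (conj_transpose U)) (A *v column j (conj_transpose U))"
  unfolding matrix_mul_assoc[symmetric]
  by (simp add: cinner_def column_def conj_transpose_def matrix_matrix_mult_def matrix_vector_mult_def)

lemma mat_1_entry: "mat 1 $ i $ j = (if i = j then 1 else 0)"
  by (simp add: mat_def)

lemma unitary_columns:
  assumes "unitary_mat U"
  shows "cinner (column i (conj_transpose U)) (column j (conj_transpose U)) = (if i = j then 1 else 0)"
  using transform_entry[of U "mat 1" i j] assms by (simp add: unitary_mat_def mat_1_entry)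

text \<open>The set \<open>transform_vectors U\<close> loses no multiplicity, so sums and products
  over coordinates can be reindexed over it.\<close>

lemma inj_unitary_columns:
  assumes "unitary_mat U"
  shows "inj (\<lambda>i. column i (conj_transpose U))"
proof (rule injI)
  fix i j assume "column i (conj_transpose U) = column j (conj_transpose U)"
  with unitary_columns[OF assms, of i j] unitary_columns[OF assms, of i i] show "i = j"
    by (auto split: if_splits)
qed

lemma transform_vectors_orthonormal_basis:
  assumes U: "unitary_mat U"
  shows "orthonormal_basis UNIV (transform_vectors U)"
proof -
  have ons: "orthonormal_set (transform_vectors U)"
    using unitary_columns[OF U]
    by (auto simp: orthonormal_set_def transform_vectors_def) (metis zero_neq_one)
  have "x \<in> vec.span (transform_vectors U)" for x
  proof -
    let ?s = "\<Sum>c\<in>transform_vectors U. cinner c x *s c"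
    \<comment> \<open>The coordinates of \<open>U *v y\<close> are the coefficients of
      \<open>y\<close> at the transform vectors. They vanish for the residual of \<open>x\<close>,
      and \<open>U\<close> is invertible.\<close>
    have "(U *v (x - ?s)) $ i = 0" for i
    proof -
      have "(U *v (x - ?s)) $ i = cinner (column i (conj_transpose U)) (x - ?s)"
        by (simp add: cinner_def matrix_vector_mult_def column_def conj_transpose_def)
      also have "\<dots> = 0"
        by (rule orthonormal_residual[OF ons]) (auto simp: transform_vectors_def)
      finally show ?thesis .
    qed
    then have "U *v (x - ?s) = 0"
      by (simp add: vec_eq_iff)
    then have "conj_transpose U *v (U *v (x - ?s)) = 0"
      by simp
    then have "x = ?s"
      using U by (simp add: matrix_vector_mul_assoc unitary_mat_def)
    also have "?s \<in> vec.span (transform_vectors U)"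
      by (intro vec.span_sum vec.span_scale) (rule vec.span_base)
    finally show ?thesis .
  qed
  then show ?thesis
    using ons by (auto simp: orthonormal_basis_alt)
qed

text \<open>Any enumeration of the basis by the index type will do, since rate and realization see
  only the set of transform vectors.\<close>

lemma unitary_of_orthonormal_basis:
  fixes B :: "(complex ^ 'n) set"
  assumes B: "orthonormal_basis UNIV B"
  obtains U where "unitary_mat U" "transform_vectors U = B"
proof -
  have "card B = CARD('n)"
    using orthonormal_basis_card[OF B] by (simp add: card_cart_basis)
  then obtain e :: "'n \<Rightarrow> complex ^ 'n" where e: "bij_betw e UNIV B"
    using finite_same_card_bij[of "UNIV :: 'n set" B] orthonormal_basis_finite[OF B] by auto
  define U :: "complex ^ 'n ^ 'n" where "U = (\<chi> i j. cnj (e i $ j))"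
  have col: "column i (conj_transpose U) = e i" for i
    by (simp add: column_def conj_transpose_def U_def vec_eq_iff)
  have "U ** conj_transpose U = mat 1"
  proof -
    have "(U ** conj_transpose U) $ i $ j = (mat 1 :: complex ^ 'n ^ 'n) $ i $ j" for i j
      using transform_entry[of U "mat 1" i j] orthonormal_basis_cinner[OF B, of "e i" "e j"]
        bij_betwE[OF e] bij_betw_imp_inj_on[OF e]
      by (simp add: col mat_1_entry inj_eq)
    then show ?thesis
      by (simp add: vec_eq_iff)
  qed
  then have "unitary_mat U"
    by (simp add: unitary_mat_def matrix_left_right_inverse)
  moreover have "transform_vectors U = B"
    using e by (simp add: transform_vectors_def col bij_betw_def)
  ultimately show thesis
    by (rule that)
qed

lemma coding_rate_eq:
  assumes "unitary_mat U"
  shows "coding_rate \<kappa> R U = (\<Sum>b\<in>transform_vectors U. ln (Re (cinner b (R *v b)))) / 2 + \<kappa>"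
  unfolding coding_rate_def transform_entry transform_vectors_def
  by (simp add: sum.reindex inj_unitary_columns[OF assms])

text \<open>Connects the two determinants in play, that of list-indexed matrices inside
  \<open>det_on\<close> and that of \<open>complex ^ 'n ^ 'n\<close>: both are the product of the
  eigenvalues.\<close>

lemma det_on_UNIV:
  fixes R :: "complex ^ 'n ^ 'n"
  assumes "conj_transpose R = R"
  shows "det_on UNIV R = det R"
proof -
  obtain B where B: "orthonormal_eigenbasis UNIV R B"
    using hermitian_orthonormal_eigenbasis[OF assms] by (metis UNIV_I vec.subspace_UNIV)
  then have "orthonormal_basis UNIV B"
    by (simp add: orthonormal_eigenbasis_def)
  then obtain U where U: "unitary_mat U" "transform_vectors U = B"
    by (rule unitary_of_orthonormal_basis)
  let ?u = "\<lambda>i. column i (conj_transpose U)"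
  have "det R = det (conj_transpose U ** U) * det R"
    using U by (simp add: unitary_mat_def)
  also have "\<dots> = det (U ** R ** conj_transpose U)"
    by (simp add: det_mul)
  also have "\<dots> = (\<Prod>i\<in>UNIV. (U ** R ** conj_transpose U) $ i $ i)"
  proof (rule det_diagonal)
    fix i j :: 'n assume "i \<noteq> j"
    then have "?u i \<noteq> ?u j"
      using inj_unitary_columns[OF U(1)] by (auto dest: injD)
    then show "(U ** R ** conj_transpose U) $ i $ j = 0"
      unfolding transform_entry
      by (intro eigenbasis_off_diagonal[OF B]) (auto simp flip: U(2) simp: transform_vectors_def)
  qed
  also have "\<dots> = (\<Prod>b\<in>B. cinner b (R *v b))"
    unfolding transform_entry U(2)[symmetric] transform_vectors_def
    by (simp add: prod.reindex inj_unitary_columns[OF U(1)])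
  finally show ?thesis
    using det_on_eigenbasis[OF B] by simp
qed

section \<open>Hadamard's inequality and the optimal rate\<close>

lemma ln_det_eigenbasis:
  assumes R: "pos_def R" and E: "orthonormal_eigenbasis UNIV R E"
  shows "ln (Re (det R)) = (\<Sum>e\<in>E. ln (Re (cinner e (R *v e))))"
  using ln_det_on_compression[of R UNIV E 1] assms
  by (simp add: compression_UNIV det_on_UNIV pos_def_hermitian)

text \<open>
  The squared moduli of the coefficients between two orthonormal bases form a doubly stochastic
  matrix; concavity of \<open>ln\<close> enters as \<open>ln x \<le> x - 1\<close>.
\<close>

lemma hadamard_inequality:
  fixes R :: "complex ^ 'n ^ 'n"
  assumes R: "pos_def R" and B: "orthonormal_basis UNIV B"
  shows "ln (Re (det R)) \<le> (\<Sum>b\<in>B. ln (Re (cinner b (R *v b))))"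
proof -
  obtain E where E: "orthonormal_eigenbasis UNIV R E"
    using hermitian_orthonormal_eigenbasis[OF pos_def_hermitian[OF R]] by (metis UNIV_I vec.subspace_UNIV)
  then have onE: "orthonormal_basis UNIV E"
    by (simp add: orthonormal_eigenbasis_def)
  define q where "q x = Re (cinner x (R *v x))" for x
  define p where "p e b = (cmod (cinner e b))\<^sup>2" for e b :: "complex ^ 'n"
  have p_eq: "cinner b e * cinner e b = complex_of_real (p e b)" for e b
    unfolding p_def complex_norm_square by (simp add: cnj_cinner mult.commute)
  have p_comm: "p e b = p b e" for e b
    unfolding p_def by (metis cnj_cinner complex_mod_cnj)
  have sum_p: "(\<Sum>e\<in>F. p e b) = 1" if "orthonormal_basis UNIV F" "cinner b b = 1" for F and b :: "complex ^ 'n"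
  proof -
    have "complex_of_real (\<Sum>e\<in>F. p e b) = 1"
      using orthonormal_basis_cinner_expand[OF that(1), of b b] that(2) by (simp add: p_eq)
    then show ?thesis
      using of_real_eq_1_iff by blast
  qed
  have pos: "0 < q b" if "cinner b b = 1" for b
    using pos_def_cinner_pos[OF R that] by (simp add: q_def)
  have q_expand: "q b = (\<Sum>e\<in>E. p e b * q e)" for b
  proof -
    have "cinner b (R *v b) = (\<Sum>e\<in>E. cinner b e * cinner e (R *v b))"
      using orthonormal_basis_cinner_expand[OF onE] by blast
    also have "\<dots> = (\<Sum>e\<in>E. complex_of_real (p e b * q e))"
    proof (rule sum.cong)
      fix e assume e: "e \<in> E"
      have "cinner e (R *v b) = cinner (R *v e) b"
        by (simp add: cinner_hermitian pos_def_hermitian R)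
      also have "\<dots> = complex_of_real (q e) * cinner e b"
        by (subst eigenbasis_eigenvector[OF E e])
          (simp add: cinner_scale_left q_def, metis complex_cnj_complex_of_real pos_def_cinner_eq[OF R])
      finally show "cinner b e * cinner e (R *v b) = complex_of_real (p e b * q e)"
        by (simp flip: p_eq)
    qed simp
    finally show ?thesis
      by (simp add: q_def)
  qed
  have unitE: "cinner e e = 1" if "e \<in> E" for e
    using orthonormal_basis_cinner[OF onE that that] by simp
  have jensen: "(\<Sum>e\<in>E. p e b * ln (q e)) \<le> ln (q b)" if b: "cinner b b = 1" for b
  proof -
    \<comment> \<open>Tangent of \<open>ln\<close> at \<open>q b\<close>. The correction terms sum
      to 0, as the weights \<open>p e b\<close> have total 1 and average the values
      \<open>q e\<close> to \<open>q b\<close>.\<close>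
    have "(\<Sum>e\<in>E. p e b * ln (q e)) \<le> (\<Sum>e\<in>E. p e b * ln (q b) + (p e b * q e / q b - p e b))"
    proof (rule sum_mono)
      fix e assume e: "e \<in> E"
      have "ln (q e) - ln (q b) \<le> q e / q b - 1"
        using ln_le_minus_one[of "q e / q b"] pos[OF b] pos[OF unitE[OF e]] by (simp add: ln_div)
      then have "p e b * (ln (q e) - ln (q b)) \<le> p e b * (q e / q b - 1)"
        by (intro mult_left_mono) (simp_all add: p_def)
      then show "p e b * ln (q e) \<le> p e b * ln (q b) + (p e b * q e / q b - p e b)"
        by (simp add: algebra_simps)
    qed
    also have "\<dots> = (\<Sum>e\<in>E. p e b) * ln (q b) + ((\<Sum>e\<in>E. p e b * q e) / q b - (\<Sum>e\<in>E. p e b))"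
      by (simp add: sum.distrib sum_subtractf sum_divide_distrib sum_distrib_right)
    also have "\<dots> = ln (q b)"
      using sum_p[OF onE b] pos[OF b] by (simp flip: q_expand)
    finally show ?thesis .
  qed
  \<comment> \<open>The other half of double stochasticity: each \<open>ln (q e)\<close> is spread
    over \<open>B\<close> with total weight 1, and after exchanging the sums \<open>jensen\<close>
    applies to each \<open>b\<close>.\<close>
  have "ln (Re (det R)) = (\<Sum>e\<in>E. (\<Sum>b\<in>B. p b e) * ln (q e))"
    using ln_det_eigenbasis[OF R E] sum_p[OF B unitE] by (simp add: q_def)
  also have "\<dots> = (\<Sum>e\<in>E. \<Sum>b\<in>B. p e b * ln (q e))"
    unfolding sum_distrib_right by (subst p_comm) (rule refl)
  also have "\<dots> = (\<Sum>b\<in>B. \<Sum>e\<in>E. p e b * ln (q e))"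
    by (rule sum.swap)
  also have "\<dots> \<le> (\<Sum>b\<in>B. ln (q b))"
    using orthonormal_basis_cinner[OF B] by (intro sum_mono jensen) simp
  finally show ?thesis
    by (simp add: q_def)
qed

text \<open>The infimum is a minimum, attained by the transform made of an eigenbasis of
  \<open>R\<close>.\<close>

lemma Inf_coding_rate:
  assumes R: "pos_def R"
  shows "Inf (coding_rate \<kappa> R ` {U. unitary_mat U}) = ln (Re (det R)) / 2 + \<kappa>"
proof (rule cInf_eq_minimum)
  obtain E where E: "orthonormal_eigenbasis UNIV R E"
    using hermitian_orthonormal_eigenbasis[OF pos_def_hermitian[OF R]] by (metis UNIV_I vec.subspace_UNIV)
  then obtain U where "unitary_mat U" "transform_vectors U = E"
    using unitary_of_orthonormal_basis[of E] by (auto simp: orthonormal_eigenbasis_def)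
  then have "unitary_mat U \<and> ln (Re (det R)) / 2 + \<kappa> = coding_rate \<kappa> R U"
    using coding_rate_eq[of U \<kappa> R] ln_det_eigenbasis[OF R E] by simp
  then show "ln (Re (det R)) / 2 + \<kappa> \<in> coding_rate \<kappa> R ` {U. unitary_mat U}"
    by blast
next
  fix r assume "r \<in> coding_rate \<kappa> R ` {U. unitary_mat U}"
  then obtain U where "unitary_mat U" "r = coding_rate \<kappa> R U"
    by blast
  then show "ln (Re (det R)) / 2 + \<kappa> \<le> r"
    using hadamard_inequality[OF R transform_vectors_orthonormal_basis] by (simp add: coding_rate_eq)
qed

section \<open>Orthogonality of the sectors\<close>

definition orthogonal_family :: "(complex ^ 'n) set set \<Rightarrow> bool" where
  "orthogonal_family T \<longleftrightarrow> (\<forall>W\<in>T. vec.subspace W) \<and>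
     (\<forall>W\<in>T. \<forall>W'\<in>T. W \<noteq> W' \<longrightarrow> (\<forall>x\<in>W. \<forall>y\<in>W'. cinner x y = 0))"

lemma orthogonal_family_subset: "orthogonal_family T \<Longrightarrow> T' \<subseteq> T \<Longrightarrow> orthogonal_family T'"
  by (simp add: orthogonal_family_def subset_iff) meson

lemma orthogonal_family_subspace: "orthogonal_family T \<Longrightarrow> W \<in> T \<Longrightarrow> vec.subspace W"
  by (simp add: orthogonal_family_def)

lemma orthogonal_family_orthogonal:
  "orthogonal_family T \<Longrightarrow> W \<in> T \<Longrightarrow> W' \<in> T \<Longrightarrow> W \<noteq> W' \<Longrightarrow> x \<in> W \<Longrightarrow> y \<in> W' \<Longrightarrow> cinner x y = 0"
  unfolding orthogonal_family_def by blast

text \<open>One unit vector from each member gives an orthonormal set of the same size as the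
  family, and such sets are finite.\<close>

lemma orthogonal_family_finite:
  assumes T: "orthogonal_family T" "{0} \<notin> T"
  shows "finite T"
proof -
  have "\<exists>x. x \<in> W \<and> cinner x x = 1" if W: "W \<in> T" for W
  proof -
    have sub: "vec.subspace W"
      using T W by (simp add: orthogonal_family_subspace)
    moreover have "W \<noteq> {0}"
      using T W by auto
    ultimately obtain y where "y \<in> W" "y \<noteq> 0"
      using vec.subspace_0 by blast
    then show ?thesis
      using normalized_in_subspace[OF sub] cinner_self_eq_1_iff by blast
  qed
  then obtain f where f: "\<And>W. W \<in> T \<Longrightarrow> f W \<in> W \<and> cinner (f W) (f W) = 1"
    by metis
  have orth: "cinner (f W) (f W') = 0" if "W \<in> T" "W' \<in> T" "W \<noteq> W'" for W W'
    using f that orthogonal_family_orthogonal[OF T(1)] by blast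
  have "inj_on f T"
  proof (rule inj_onI)
    fix W W' assume W: "W \<in> T" "W' \<in> T" "f W = f W'"
    then have "cinner (f W) (f W') \<noteq> 0"
      using f by (metis zero_neq_one)
    then show "W = W'"
      using orth W by blast
  qed
  moreover have "orthonormal_set (f ` T)"
    using f orth by (auto simp: orthonormal_set_def)
  then have "finite (f ` T)"
    by (rule orthonormal_set_finite)
  ultimately show ?thesis
    using finite_imageD by blast
qed

section \<open>Joint spaces, their bases and projections\<close>

lemma joint_space_subspace: "vec.subspace (joint_space T)"
  by (simp add: joint_space_def)

lemma joint_space_empty: "joint_space {} = {0}"
  by (simp add: joint_space_def)

lemma joint_space_singleton: "vec.subspace W \<Longrightarrow> joint_space {W} = W"
  by (simp add: joint_space_def)

lemma joint_space_superset: "W \<in> T \<Longrightarrow> W \<subseteq> joint_space T"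
  unfolding joint_space_def by (meson Union_upper order_trans vec.span_superset)

lemma joint_space_orthogonal:
  assumes F: "orthogonal_family F" and T: "T \<subseteq> F" "T' \<subseteq> F" "T \<inter> T' = {}"
    and xy: "x \<in> joint_space T" "y \<in> joint_space T'"
  shows "cinner x y = 0"
proof (rule cinner_span_span_zero[OF _ xy[unfolded joint_space_def]])
  fix x y assume "x \<in> \<Union>T" "y \<in> \<Union>T'"
  then show "cinner x y = 0"
    using T orthogonal_family_orthogonal[OF F] by blast
qed

lemma joint_space_basis:
  assumes F: "orthogonal_family T" and B: "\<And>W. W \<in> T \<Longrightarrow> orthonormal_basis W (B W)"
  shows "orthonormal_basis (joint_space T) (\<Union>W\<in>T. B W)"
proof -
  have "orthonormal_set (\<Union>W\<in>T. B W)"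
    unfolding orthonormal_set_def
  proof safe
    fix W W' x y assume W: "W \<in> T" "x \<in> B W" "W' \<in> T" "y \<in> B W'"
    show "cinner x y = (if x = y then 1 else 0)"
    proof (cases "W = W'")
      case True
      then show ?thesis
        using W orthonormal_basis_cinner[OF B] by blast
    next
      case False
      then have "cinner x y = 0"
        using W orthonormal_basis_in[OF B] orthogonal_family_orthogonal[OF F] by blast
      moreover have "cinner x x = 1"
        using W orthonormal_basis_cinner[OF B] by simp
      ultimately show ?thesis
        by auto
    qed
  qed
  moreover have "vec.span (\<Union>W\<in>T. B W) = joint_space T"
    unfolding joint_space_def vec.span_eq
  proof safe
    fix W x assume "W \<in> T" "x \<in> B W"
    then show "x \<in> vec.span (\<Union>T)"
      using orthonormal_basis_in[OF B] by (blast intro: vec.span_base)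
  next
    fix W x assume W: "x \<in> W" "W \<in> T"
    then have "x \<in> vec.span (B W)"
      using B by (simp add: orthonormal_basis_alt)
    also have "\<dots> \<subseteq> vec.span (\<Union>W\<in>T. B W)"
      using W by (intro vec.span_mono) blast
    finally show "x \<in> vec.span (\<Union>W\<in>T. B W)" .
  qed
  ultimately show ?thesis
    by (simp add: orthonormal_basis_alt)
qed

lemma joint_space_union_basis:
  assumes F: "orthogonal_family F" and T: "T \<subseteq> F" "T' \<subseteq> F" "T \<inter> T' = {}"
    and B: "orthonormal_basis (joint_space T) B" "orthonormal_basis (joint_space T') B'"
  shows "orthonormal_basis (joint_space (T \<union> T')) (B \<union> B')" "B \<inter> B' = {}"
proof -
  have orth: "cinner x y = 0" "cinner y x = 0" if "x \<in> B" "y \<in> B'" for x y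
    using joint_space_orthogonal[OF F T] that orthonormal_basis_in[OF B(1)] orthonormal_basis_in[OF B(2)]
    by (auto simp: cinner_eq_0_commute[of y x])
  have unit: "cinner x x = 1" if "x \<in> B" for x
    using orthonormal_basis_cinner[OF B(1) that that] by simp
  show disj: "B \<inter> B' = {}"
    using orth unit by fastforce
  have "vec.span (B \<union> B') = joint_space (T \<union> T')"
    unfolding joint_space_def Union_Un_distrib vec.span_Un
    using B by (simp add: orthonormal_basis_alt joint_space_def)
  moreover have "orthonormal_set (B \<union> B')"
    using B disj orth by (auto simp: orthonormal_basis_alt orthonormal_set_def)
  ultimately show "orthonormal_basis (joint_space (T \<union> T')) (B \<union> B')"
    by (simp add: orthonormal_basis_alt)
qed

lemma dim_joint_space_Un:
  assumes F: "orthogonal_family F" and T: "T \<subseteq> F" "T' \<subseteq> F" "T \<inter> T' = {}"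
  shows "vec.dim (joint_space (T \<union> T')) = vec.dim (joint_space T) + vec.dim (joint_space T')"
proof -
  obtain B B' where B: "orthonormal_basis (joint_space T) B" "orthonormal_basis (joint_space T') B'"
    using orthonormal_basis_exists[OF joint_space_subspace] by metis
  then show ?thesis
    using joint_space_union_basis[OF F T B] card_Un_disjoint[of B B']
    by (simp add: orthonormal_basis_finite flip: orthonormal_basis_card)
qed

lemma dim_joint_space:
  assumes "finite T" "orthogonal_family T"
  shows "vec.dim (joint_space T) = (\<Sum>W\<in>T. vec.dim W)"
  using assms
proof (induction T rule: finite_induct)
  case empty
  then show ?case
    by (simp add: joint_space_empty)
next
  case (insert W T)
  have "vec.dim (joint_space ({W} \<union> T)) = vec.dim (joint_space {W}) + vec.dim (joint_space T)"
    using insert by (intro dim_joint_space_Un[of "insert W T"]) auto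
  then show ?case
    using insert orthogonal_family_subset[of "insert W T" T]
    by (simp add: joint_space_singleton orthogonal_family_subspace subset_insertI)
qed

text \<open>The sum of projections satisfies the characterization of the projection onto the joint
  space: against a vector of one member, all summands but that member's vanish.\<close>

lemma joint_proj_eq:
  assumes T: "finite T" "orthogonal_family T"
  shows "joint_proj T = proj (joint_space T)"
proof -
  note sub = orthogonal_family_subspace[OF T(2)]
  have "proj (joint_space T) *v x = joint_proj T *v x" for x
  proof (rule proj_unique[OF joint_space_subspace])
    have eq: "joint_proj T *v x = (\<Sum>W\<in>T. proj W *v x)"
      unfolding joint_proj_def using T(1)
      by (induction T rule: finite_induct) (simp_all add: matrix_vector_mult_add_rdistrib)
    show "joint_proj T *v x \<in> joint_space T"
      unfolding eq joint_space_def
      using proj_in[OF sub] by (intro vec.span_sum vec.span_base) blast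
    fix w assume w: "w \<in> joint_space T"
    have "cinner (x - joint_proj T *v x) v = 0" if v: "v \<in> \<Union>T" for v
    proof -
      obtain W where W: "W \<in> T" "v \<in> W"
        using v by blast
      have "cinner v (joint_proj T *v x) = (\<Sum>W'\<in>T. cinner v (proj W' *v x))"
        by (simp add: eq cinner_sum_right)
      also have "\<dots> = (\<Sum>W'\<in>T. if W = W' then cinner v x else 0)"
        using W sub cinner_proj_right[OF sub W(2)] orthogonal_family_orthogonal[OF T(2) W(1) _ _ W(2) proj_in[OF sub]]
        by (intro sum.cong) auto
      also have "\<dots> = cinner v x"
        using W T by simp
      finally have "cinner v (x - joint_proj T *v x) = 0"
        by (simp add: cinner_diff_right)
      then show ?thesis
        by (subst cinner_eq_0_commute)
    qed
    then have "cinner (x - joint_proj T *v x) w = 0"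
      using w unfolding joint_space_def by (rule cinner_span_zero)
    then show "cinner w (x - joint_proj T *v x) = 0"
      by (subst cinner_eq_0_commute)
  qed
  then show ?thesis
    by (simp add: matrix_eq)
qed

lemma joint_block_eq:
  "finite T \<Longrightarrow> orthogonal_family T \<Longrightarrow> joint_block R T = compression R (joint_space T)"
  by (simp add: joint_block_def compression_def joint_proj_eq)

section \<open>Unitary representations and invariant subspaces\<close>

lemma unitary_preserves_cinner: "unitary_mat U \<Longrightarrow> cinner (U *v x) (U *v y) = cinner x y"
  by (subst cinner_conj_transpose[symmetric]) (simp add: matrix_vector_mul_assoc unitary_mat_def)

text \<open>\<open>unitary_rep\<close> only postulates multiplicativity; the image of the unit is
  idempotent and invertible, hence the identity.\<close>

lemma unitary_rep_one:
  assumes "unitary_rep G V"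
  shows "V \<one>\<^bsub>G\<^esub> = mat 1"
proof -
  interpret Group.group G
    using assms by (simp add: unitary_rep_def)
  have "V \<one>\<^bsub>G\<^esub> ** V \<one>\<^bsub>G\<^esub> = V \<one>\<^bsub>G\<^esub>" "unitary_mat (V \<one>\<^bsub>G\<^esub>)"
    using assms by (auto simp: unitary_rep_def) (metis one_closed r_one)
  then show ?thesis
    by (metis matrix_mul_assoc matrix_mul_lid unitary_mat_def)
qed

text \<open>The adjoint of \<open>V g\<close> belongs to the inverse group element and so preserves
  the same subspaces. This carries invariance over to orthogonal complements and to
  projections.\<close>

lemma unitary_rep_cinner:
  assumes V: "unitary_rep G V" and g: "g \<in> carrier G"
  shows "cinner x (V g *v y) = cinner (V (inv\<^bsub>G\<^esub> g) *v x) y"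
proof -
  interpret Group.group G
    using V by (simp add: unitary_rep_def)
  have "cinner (V (inv\<^bsub>G\<^esub> g) *v x) y = cinner (V g *v (V (inv\<^bsub>G\<^esub> g) *v x)) (V g *v y)"
    using V g by (simp add: unitary_preserves_cinner unitary_rep_def)
  also have "V g ** V (inv\<^bsub>G\<^esub> g) = mat 1"
    using V g unitary_rep_one[OF V] by (metis inv_closed r_inv unitary_rep_def)
  then have "V g *v (V (inv\<^bsub>G\<^esub> g) *v x) = x"
    by (simp add: matrix_vector_mul_assoc)
  finally show ?thesis
    by simp
qed

lemma invariant_orthogonal_complement:
  assumes V: "unitary_rep G V" and W: "invariant_subspace G V W"
  shows "invariant_subspace G V {x. \<forall>w\<in>W. cinner w x = 0}"
proof -
  interpret Group.group G
    using V by (simp add: unitary_rep_def)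
  have "cinner w (V g *v x) = 0" if "g \<in> carrier G" "w \<in> W" "\<forall>w\<in>W. cinner w x = 0" for g w x
    using that W unitary_rep_cinner[OF V that(1)] by (simp add: invariant_subspace_def)
  then show ?thesis
    by (auto simp: invariant_subspace_def vec.subspace_def cinner_add_right cinner_scale_right)
qed

lemma proj_intertwines:
  assumes V: "unitary_rep G V" and W: "invariant_subspace G V W" and g: "g \<in> carrier G"
  shows "proj W *v (V g *v x) = V g *v (proj W *v x)"
proof (rule proj_unique)
  show sub: "vec.subspace W"
    using W by (simp add: invariant_subspace_def)
  show "V g *v (proj W *v x) \<in> W"
    using W g proj_in[OF sub] by (simp add: invariant_subspace_def)
  fix w assume w: "w \<in> W"
  interpret Group.group G
    using V by (simp add: unitary_rep_def)
  have "V (inv\<^bsub>G\<^esub> g) *v w \<in> W"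
    using W g w by (simp add: invariant_subspace_def)
  then show "cinner w (V g *v x - V g *v (proj W *v x)) = 0"
    using proj_residual[OF sub] unitary_rep_cinner[OF V g, of w "x - proj W *v x"]
    by (simp add: vec.diff)
qed

section \<open>Equivalence of subrepresentations and Schur's lemma\<close>

lemma equivalent_subreps_refl: "equivalent_subreps G V W W"
  unfolding equivalent_subreps_def
  by (rule exI[of _ "mat 1"]) (auto simp: bij_betw_def inj_on_def)

lemma equivalent_subreps_trans:
  assumes "equivalent_subreps G V W W'" "equivalent_subreps G V W' W''"
  shows "equivalent_subreps G V W W''"
proof -
  obtain F where F: "bij_betw ((*v) F) W W'"
      "\<And>g w. g \<in> carrier G \<Longrightarrow> w \<in> W \<Longrightarrow> F *v (V g *v w) = V g *v (F *v w)"
    using assms(1) unfolding equivalent_subreps_def by blast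
  obtain F' where F': "bij_betw ((*v) F') W' W''"
      "\<And>g w. g \<in> carrier G \<Longrightarrow> w \<in> W' \<Longrightarrow> F' *v (V g *v w) = V g *v (F' *v w)"
    using assms(2) unfolding equivalent_subreps_def by blast
  have eq: "(*v) (F' ** F) = (*v) F' \<circ> (*v) F"
    by (auto simp: matrix_vector_mul_assoc)
  have "bij_betw ((*v) (F' ** F)) W W''"
    unfolding eq using F(1) F'(1) by (rule bij_betw_trans)
  moreover have "(F' ** F) *v (V g *v w) = V g *v ((F' ** F) *v w)" if "g \<in> carrier G" "w \<in> W" for g w
    using F(2)[OF that] F'(2)[OF that(1) bij_betwE[OF F(1), rule_format, OF that(2)]]
    by (simp flip: matrix_vector_mul_assoc)
  ultimately show ?thesis
    unfolding equivalent_subreps_def by blast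
qed

text \<open>
  The inverse of the intertwiner is only given on \<open>W'\<close>; composing it with \<open>proj W'\<close> makes it a
  linear map on the whole space.
\<close>

lemma equivalent_subreps_sym:
  fixes V :: "'g \<Rightarrow> complex ^ 'n ^ 'n"
  assumes W: "invariant_subspace G V W" "invariant_subspace G V W'"
    and eq: "equivalent_subreps G V W W'"
  shows "equivalent_subreps G V W' W"
proof -
  obtain F where F: "bij_betw ((*v) F) W W'"
      "\<And>g w. g \<in> carrier G \<Longrightarrow> w \<in> W \<Longrightarrow> F *v (V g *v w) = V g *v (F *v w)"
    using eq unfolding equivalent_subreps_def by blast
  have sub: "vec.subspace W" "vec.subspace W'"
    using W by (auto simp: invariant_subspace_def)
  have inj: "x = y" if "x \<in> W" "y \<in> W" "F *v x = F *v y" for x y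
    using F(1) that by (auto simp: bij_betw_def inj_on_def)
  define h where "h = the_inv_into W ((*v) F)"
  have h: "h y \<in> W" "F *v h y = y" if "y \<in> W'" for y
    using F(1) that unfolding h_def bij_betw_def
    by (metis order_refl the_inv_into_into, metis f_the_inv_into_f)
  have h_unique: "h y = x" if "x \<in> W" "F *v x = y" "y \<in> W'" for x y
    using h[OF that(3)] that inj by simp
  define k where "k x = h (proj W' *v x)" for x
  note p = proj_in[OF sub(2)]
  have "Vector_Spaces.linear (*s) (*s) k"
  proof (unfold_locales)
    fix x y
    show "k (x + y) = k x + k y"
      unfolding k_def using h p sub
      by (intro h_unique) (simp_all add: vec.add vec.subspace_add)
    fix c
    show "k (c *s x) = c *s k x"
      unfolding k_def using h p sub
      by (intro h_unique) (simp_all add: vec.scale vec.subspace_scale)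
  qed
  then have k: "matrix k *v x = k x" for x
    by (rule matrix_works)
  have kh: "matrix k *v y = h y" if "y \<in> W'" for y
    unfolding k k_def using that proj_id[OF sub(2)] by simp
  have "bij_betw h W' W"
    unfolding h_def using F(1) by (rule bij_betw_the_inv_into)
  then have "bij_betw ((*v) (matrix k)) W' W"
    using kh by (subst bij_betw_cong[of _ _ h]) auto
  moreover have "matrix k *v (V g *v y) = V g *v (matrix k *v y)" if "g \<in> carrier G" "y \<in> W'" for g y
  proof -
    have "V g *v y \<in> W'" "V g *v h y \<in> W"
      using W that h by (auto simp: invariant_subspace_def)
    moreover have "F *v (V g *v h y) = V g *v y"
      using F(2)[OF that(1) h(1)[OF that(2)]] h(2)[OF that(2)] by simp
    ultimately have "h (V g *v y) = V g *v h y"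
      by (intro h_unique)
    then show ?thesis
      using kh[OF \<open>V g *v y \<in> W'\<close>] kh[OF that(2)] by simp
  qed
  ultimately show ?thesis
    unfolding equivalent_subreps_def by blast
qed

text \<open>
  Schur's lemma for \<open>proj W\<close> restricted to \<open>W'\<close>, an intertwiner that is nonzero since
  \<open>cinner x y \<noteq> 0\<close>.
\<close>

lemma irreducible_orthogonal_or_equivalent:
  fixes V :: "'g \<Rightarrow> complex ^ 'n ^ 'n"
  assumes V: "unitary_rep G V"
    and W: "irreducible_subspace G V W" "irreducible_subspace G V W'"
    and xy: "x \<in> W" "y \<in> W'" "cinner x y \<noteq> 0"
  shows "equivalent_subreps G V W' W"
proof -
  have inv: "invariant_subspace G V W" "invariant_subspace G V W'"
    using W by (auto simp: irreducible_subspace_def)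
  then have sub: "vec.subspace W" "vec.subspace W'"
    by (auto simp: invariant_subspace_def)
  note comm = proj_intertwines[OF V inv(1)]
  let ?K = "{z \<in> W'. proj W *v z = 0}"
  let ?I = "(*v) (proj W) ` W'"
  have nz: "proj W *v y \<noteq> 0"
    using xy cinner_proj_right[OF sub(1) xy(1), of y] by auto
  \<comment> \<open>Irreducibility of \<open>W'\<close> makes the kernel trivial; below,
    irreducibility of \<open>W\<close> makes the image all of \<open>W\<close>.\<close>
  have "invariant_subspace G V ?K"
    using inv sub unfolding invariant_subspace_def
    by (auto simp: vec.subspace_def comm vec.add vec.scale)
  moreover have "?K \<noteq> W'"
    using nz xy by blast
  ultimately have K: "?K = {0}"
    using W unfolding irreducible_subspace_def by blast
  have "V g *v z \<in> ?I" if "g \<in> carrier G" "z \<in> ?I" for g z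
    using that inv(2) by (auto simp: invariant_subspace_def comm[OF that(1), symmetric])
  then have "invariant_subspace G V ?I"
    using sub by (auto simp: invariant_subspace_def intro: vec.subspace_image)
  moreover have "?I \<subseteq> W" "?I \<noteq> {0}"
    using nz xy proj_in[OF sub(1)] by auto
  ultimately have I: "?I = W"
    using W unfolding irreducible_subspace_def by blast
  have "inj_on ((*v) (proj W)) W'"
  proof (rule inj_onI)
    fix a b assume "a \<in> W'" "b \<in> W'" "proj W *v a = proj W *v b"
    then have "a - b \<in> ?K"
      using sub by (simp add: vec.diff vec.subspace_diff)
    then show "a = b"
      unfolding K by simp
  qed
  then have "bij_betw ((*v) (proj W)) W' W"
    using I by (simp add: bij_betw_def)
  then show ?thesis
    unfolding equivalent_subreps_def using comm by blast
qed

section \<open>Isotypic components\<close>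

lemma isotypic_component_cong:
  assumes W: "irreducible_subspace G V W" "irreducible_subspace G V W'"
    and eq: "equivalent_subreps G V W W'"
  shows "isotypic_component G V W = isotypic_component G V W'"
proof -
  have "equivalent_subreps G V W' W"
    using W eq equivalent_subreps_sym by (auto simp: irreducible_subspace_def)
  then have "equivalent_subreps G V W W'' \<longleftrightarrow> equivalent_subreps G V W' W''" for W''
    using eq equivalent_subreps_trans by blast
  then show ?thesis
    by (simp add: isotypic_component_def)
qed

lemma irreducible_subset_isotypic:
  assumes "irreducible_subspace G V W"
  shows "W \<subseteq> isotypic_component G V W"
proof -
  have "W \<subseteq> \<Union>{W'. irreducible_subspace G V W' \<and> equivalent_subreps G V W W'}"
    using assms equivalent_subreps_refl by blast
  also have "\<dots> \<subseteq> isotypic_component G V W"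
    unfolding isotypic_component_def by (rule vec.span_superset)
  finally show ?thesis .
qed

text \<open>It suffices to compare irreducible generators. If two of them were not orthogonal they
  would be equivalent, and both sectors would be the same isotypic component.\<close>

lemma sectors_orthogonal_family:
  assumes V: "unitary_rep G V"
  shows "orthogonal_family (sectors G V)"
  unfolding orthogonal_family_def
proof (intro conjI ballI impI)
  fix \<rho> assume "\<rho> \<in> sectors G V"
  then show "vec.subspace \<rho>"
    by (auto simp: sectors_def isotypic_component_def)
next
  fix \<rho> \<rho>' x y
  assume \<rho>: "\<rho> \<in> sectors G V" "\<rho>' \<in> sectors G V" "\<rho> \<noteq> \<rho>'" and xy: "x \<in> \<rho>" "y \<in> \<rho>'"
  obtain W W' where W: "irreducible_subspace G V W" "\<rho> = isotypic_component G V W"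
      "irreducible_subspace G V W'" "\<rho>' = isotypic_component G V W'"
    using \<rho> by (auto simp: sectors_def)
  show "cinner x y = 0"
  proof (rule cinner_span_span_zero)
    show "x \<in> vec.span (\<Union>{U. irreducible_subspace G V U \<and> equivalent_subreps G V W U})"
      "y \<in> vec.span (\<Union>{U. irreducible_subspace G V U \<and> equivalent_subreps G V W' U})"
      using xy W by (auto simp: isotypic_component_def)
  next
    fix u u'
    assume "u \<in> \<Union>{U. irreducible_subspace G V U \<and> equivalent_subreps G V W U}"
      "u' \<in> \<Union>{U. irreducible_subspace G V U \<and> equivalent_subreps G V W' U}"
    then obtain U U' where U: "irreducible_subspace G V U" "equivalent_subreps G V W U" "u \<in> U"
        "irreducible_subspace G V U'" "equivalent_subreps G V W' U'" "u' \<in> U'"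
      by blast
    show "cinner u u' = 0"
    proof (rule ccontr)
      assume "cinner u u' \<noteq> 0"
      then have "equivalent_subreps G V U' U"
        using irreducible_orthogonal_or_equivalent[OF V] U by blast
      then have "isotypic_component G V U' = isotypic_component G V U"
        using isotypic_component_cong U by blast
      then show False
        using isotypic_component_cong[OF W(1) U(1,2)] isotypic_component_cong[OF W(3) U(4,5)] W \<rho>(3)
        by simp
    qed
  qed
qed

lemma sectors_nonzero: "{0} \<notin> sectors G V"
proof
  assume "{0} \<in> sectors G V"
  then obtain W where W: "irreducible_subspace G V W" "isotypic_component G V W = {0}"
    by (auto simp: sectors_def)
  then have "W \<subseteq> {0}" "W \<noteq> {0}" "vec.subspace W"
    using irreducible_subset_isotypic[OF W(1)]
    by (auto simp: irreducible_subspace_def invariant_subspace_def)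
  then show False
    using vec.subspace_0 by blast
qed

section \<open>Complete reducibility\<close>

lemma irreducible_subspace_exists:
  assumes W: "invariant_subspace G V W" "W \<noteq> {0}"
  obtains W' where "irreducible_subspace G V W'" "W' \<subseteq> W"
proof -
  let ?P = "\<lambda>U. invariant_subspace G V U \<and> U \<noteq> {0} \<and> U \<subseteq> W"
  \<comment> \<open>A nonzero invariant subspace of least dimension is irreducible.\<close>
  obtain U where U: "?P U" and min: "\<And>U'. ?P U' \<Longrightarrow> vec.dim U \<le> vec.dim U'"
    using W ex_has_least_nat[of ?P W vec.dim] by blast
  have "irreducible_subspace G V U"
    unfolding irreducible_subspace_def
  proof (intro conjI allI impI)
    fix U' assume U': "invariant_subspace G V U' \<and> U' \<subseteq> U"
    show "U' = {0} \<or> U' = U"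
    proof (cases "U' = {0}")
      case False
      then have "vec.dim U \<le> vec.dim U'"
        using U U' by (intro min) blast
      then show ?thesis
        using U U' vec.subspace_dim_equal[of U' U] by (auto simp: invariant_subspace_def)
    qed simp
  qed (use U in auto)
  then show thesis
    using that U by blast
qed

text \<open>The orthogonal complement of the span of all irreducible subspaces is invariant. If it
  were nonzero it would contain an irreducible subspace, which also lies in that span and would thus
  be orthogonal to itself.\<close>

lemma joint_space_sectors:
  assumes V: "unitary_rep G V"
  shows "joint_space (sectors G V) = UNIV"
proof (rule ccontr)
  let ?I = "vec.span (\<Union>{W. irreducible_subspace G V W})"
  let ?C = "{x. \<forall>w\<in>?I. cinner w x = 0}"
  assume ne: "joint_space (sectors G V) \<noteq> UNIV"
  have irr_sub: "W \<subseteq> joint_space (sectors G V)" if "irreducible_subspace G V W" for W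
    using irreducible_subset_isotypic[OF that] joint_space_superset[of "isotypic_component G V W" "sectors G V"] that
    by (auto simp: sectors_def)
  have "?I \<subseteq> joint_space (sectors G V)"
    using irr_sub by (intro vec.span_minimal joint_space_subspace) blast
  then obtain x where x: "x \<notin> ?I"
    using ne by blast
  have inv: "invariant_subspace G V ?I"
    unfolding invariant_subspace_def
  proof (intro conjI ballI)
    fix g w assume g: "g \<in> carrier G" and w: "w \<in> ?I"
    have "?I \<subseteq> {w. V g *v w \<in> ?I}"
    proof (rule vec.span_minimal)
      show "\<Union>{W. irreducible_subspace G V W} \<subseteq> {w. V g *v w \<in> ?I}"
        using g by (auto simp: irreducible_subspace_def invariant_subspace_def intro!: vec.span_base)
      show "vec.subspace {w. V g *v w \<in> ?I}"
        by (auto simp: vec.subspace_def vec.add vec.scale vec.span_add vec.span_scale vec.span_zero)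
    qed
    then show "V g *v w \<in> ?I"
      using w by blast
  qed simp
  then have sub: "vec.subspace ?I"
    by simp
  have "x - proj ?I *v x \<in> ?C" "x - proj ?I *v x \<noteq> 0"
    using proj_residual[OF sub] proj_in[OF sub, of x] x by auto
  then have "?C \<noteq> {0}"
    by blast
  then obtain W where W: "irreducible_subspace G V W" "W \<subseteq> ?C"
    by (rule irreducible_subspace_exists[OF invariant_orthogonal_complement[OF V inv]])
  have "w = 0" if w: "w \<in> W" for w
  proof -
    have "w \<in> ?I"
      using W w by (blast intro: vec.span_base)
    then have "cinner w w = 0"
      using W(2) w by blast
    then show ?thesis
      by simp
  qed
  then show False
    using W(1) vec.subspace_0 by (auto simp: irreducible_subspace_def invariant_subspace_def)
qed

section \<open>Realizing transforms and Gaussian entropies\<close>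

definition block_logdet :: "complex ^ 'n ^ 'n \<Rightarrow> (complex ^ 'n) set \<Rightarrow> real" where
  "block_logdet R W = ln (Re (det_on W (compression R W)))"

lemma block_logdet_eigenbasis:
  "pos_def R \<Longrightarrow> orthonormal_eigenbasis W (compression R W) B \<Longrightarrow>
     block_logdet R W = (\<Sum>b\<in>B. ln (Re (cinner b (R *v b))))"
  using ln_det_on_compression[of R W B 1] by (simp add: block_logdet_def)

lemma ln_det_on_scaled_compression:
  assumes "pos_def R" "vec.subspace W" "0 < c"
  shows "ln (Re (det_on W (c *\<^sub>R compression R W))) = block_logdet R W + vec.dim W * ln c"
proof -
  obtain B where B: "orthonormal_eigenbasis W (compression R W) B"
    using compression_eigenbasis_exists[OF assms(1,2)] .
  then show ?thesis
    using ln_det_on_compression[OF assms(1) B assms(3)] block_logdet_eigenbasis[OF assms(1) B] by simp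
qed

text \<open>The empty block, which occurs when \<open>S\<close> consists of all sectors or when the
  last data-driven sector is moved.\<close>

lemma block_logdet_zero:
  assumes "pos_def R"
  shows "block_logdet R {0} = 0"
proof -
  have "orthonormal_eigenbasis {0} (compression R {0}) {}"
    by (simp add: orthonormal_eigenbasis_def orthonormal_basis_def)
  from block_logdet_eigenbasis[OF assms this] show ?thesis
    by simp
qed

text \<open>Recovers a block's basis from the whole set of transform vectors, as
  \<open>realizes\<close> demands: a further vector of \<open>B\<close> in \<open>W\<close> would be
  orthogonal to all of \<open>W\<close>.\<close>

lemma orthonormal_set_inter_basis:
  assumes B: "orthonormal_set B" and B': "orthonormal_basis W B'" "B' \<subseteq> B"
  shows "B \<inter> W = B'"
proof
  show "B' \<subseteq> B \<inter> W"
    using B' orthonormal_basis_in by blast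
  show "B \<inter> W \<subseteq> B'"
  proof (rule subsetI, rule ccontr)
    fix b assume b: "b \<in> B \<inter> W" "b \<notin> B'"
    have "cinner b b = 0"
    proof (rule cinner_span_zero)
      show "b \<in> vec.span B'"
        using b B' by (simp add: orthonormal_basis_alt)
      show "cinner b y = 0" if "y \<in> B'" for y
        using B b that B'(2) by (auto simp: orthonormal_set_def)
    qed
    moreover have "cinner b b = 1"
      using B b by (simp add: orthonormal_set_def)
    ultimately show False
      by simp
  qed
qed

section \<open>Realizing transforms and their excess rate\<close>

lemma sectors_finite: "unitary_rep G V \<Longrightarrow> finite (sectors G V)"
  by (rule orthogonal_family_finite[OF sectors_orthogonal_family sectors_nonzero])

lemma realizes_iff:
  assumes V: "unitary_rep G V"
  shows "realizes G V R S U \<longleftrightarrow> unitary_mat U \<and>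
     (\<forall>\<rho>\<in>S. orthonormal_eigenbasis \<rho> (compression R \<rho>) (transform_vectors U \<inter> \<rho>)) \<and>
     orthonormal_eigenbasis (joint_space (sectors G V - S))
       (compression R (joint_space (sectors G V - S)))
       (transform_vectors U \<inter> joint_space (sectors G V - S))"
proof -
  have "joint_block R (sectors G V - S) = compression R (joint_space (sectors G V - S))"
    using V by (intro joint_block_eq)
      (auto intro: sectors_finite orthogonal_family_subset[OF sectors_orthogonal_family])
  then show ?thesis
    by (simp add: realizes_def sector_block_def compression_def Let_def)
qed

lemma joint_space_sectors_complement_basis:
  assumes V: "unitary_rep G V" and S: "S \<subseteq> sectors G V"
    and B: "\<And>\<rho>. \<rho> \<in> S \<Longrightarrow> orthonormal_basis \<rho> (B \<rho>)"
    and C: "orthonormal_basis (joint_space (sectors G V - S)) C"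
  shows "orthonormal_basis UNIV ((\<Union>\<rho>\<in>S. B \<rho>) \<union> C)" "(\<Union>\<rho>\<in>S. B \<rho>) \<inter> C = {}"
proof -
  note fam = sectors_orthogonal_family[OF V]
  have "orthonormal_basis (joint_space S) (\<Union>\<rho>\<in>S. B \<rho>)"
    by (rule joint_space_basis[OF orthogonal_family_subset[OF fam S] B])
  note * = joint_space_union_basis[OF fam S _ _ this C]
  show "orthonormal_basis UNIV ((\<Union>\<rho>\<in>S. B \<rho>) \<union> C)" "(\<Union>\<rho>\<in>S. B \<rho>) \<inter> C = {}"
    using * S by (auto simp: Un_absorb1 joint_space_sectors[OF V])
qed

lemma realizes_exists:
  assumes V: "unitary_rep G V" and R: "pos_def R" and S: "S \<subseteq> sectors G V"
  obtains U where "realizes G V R S U"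
proof -
  let ?J = "joint_space (sectors G V - S)"
  have "\<exists>B. orthonormal_eigenbasis \<rho> (compression R \<rho>) B" if "\<rho> \<in> S" for \<rho>
    using compression_eigenbasis_exists[OF R]
      orthogonal_family_subspace[OF sectors_orthogonal_family[OF V]] S that by blast
  then obtain B where B: "\<And>\<rho>. \<rho> \<in> S \<Longrightarrow> orthonormal_eigenbasis \<rho> (compression R \<rho>) (B \<rho>)"
    by metis
  obtain C where C: "orthonormal_eigenbasis ?J (compression R ?J) C"
    using compression_eigenbasis_exists[OF R joint_space_subspace] .
  have onb: "\<And>\<rho>. \<rho> \<in> S \<Longrightarrow> orthonormal_basis \<rho> (B \<rho>)" "orthonormal_basis ?J C"
    using B C by (auto simp: orthonormal_eigenbasis_def)
  let ?D = "(\<Union>\<rho>\<in>S. B \<rho>) \<union> C"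
  have D: "orthonormal_basis UNIV ?D"
    by (rule joint_space_sectors_complement_basis(1)[OF V S onb])
  then obtain U where U: "unitary_mat U" "transform_vectors U = ?D"
    by (rule unitary_of_orthonormal_basis)
  have ons: "orthonormal_set ?D"
    using D by (simp add: orthonormal_basis_alt)
  have "?D \<inter> \<rho> = B \<rho>" if "\<rho> \<in> S" for \<rho>
    using that by (intro orthonormal_set_inter_basis[OF ons onb(1)]) auto
  moreover have "?D \<inter> ?J = C"
    by (intro orthonormal_set_inter_basis[OF ons onb(2)]) auto
  ultimately have "realizes G V R S U"
    unfolding realizes_iff[OF V] U(2) using U(1) B C by simp
  then show thesis
    by (rule that)
qed

lemma realizes_excess_rate:
  assumes V: "unitary_rep G V" and R: "pos_def R" and S: "S \<subseteq> sectors G V"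
    and U: "realizes G V R S U"
  shows "excess_rate \<kappa> R U =
    ((\<Sum>\<rho>\<in>S. block_logdet R \<rho>) + block_logdet R (joint_space (sectors G V - S))
      - ln (Re (det R))) / 2"
proof -
  let ?J = "joint_space (sectors G V - S)" and ?B = "transform_vectors U"
  let ?D = "(\<Union>\<rho>\<in>S. ?B \<inter> \<rho>) \<union> ?B \<inter> ?J"
  let ?q = "\<lambda>b. ln (Re (cinner b (R *v b)))"
  note fam = sectors_orthogonal_family[OF V]
  have unit: "unitary_mat U"
    and eb: "\<And>\<rho>. \<rho> \<in> S \<Longrightarrow> orthonormal_eigenbasis \<rho> (compression R \<rho>) (?B \<inter> \<rho>)"
      "orthonormal_eigenbasis ?J (compression R ?J) (?B \<inter> ?J)"
    using U by (auto simp: realizes_iff[OF V])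
  then have onb: "\<And>\<rho>. \<rho> \<in> S \<Longrightarrow> orthonormal_basis \<rho> (?B \<inter> \<rho>)" "orthonormal_basis ?J (?B \<inter> ?J)"
    by (auto simp: orthonormal_eigenbasis_def)
  have B: "orthonormal_basis UNIV ?B"
    using transform_vectors_orthonormal_basis[OF unit] .
  have finB: "finite ?B"
    using orthonormal_basis_finite[OF B] .
  have D: "orthonormal_basis UNIV ?D" and disj: "(\<Union>\<rho>\<in>S. ?B \<inter> \<rho>) \<inter> (?B \<inter> ?J) = {}"
    using joint_space_sectors_complement_basis[OF V S onb] by auto
  \<comment> \<open>The vectors inside the blocks already form a basis of the whole space, so by
    cardinality no transform vector lies across several blocks.\<close>
  have "?D = ?B"
    using orthonormal_basis_card[OF D] orthonormal_basis_card[OF B] finB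
    by (intro card_subset_eq) auto
  then have "(\<Sum>b\<in>?B. ?q b) = (\<Sum>b\<in>?D. ?q b)"
    by simp
  also have "\<dots> = (\<Sum>b\<in>(\<Union>\<rho>\<in>S. ?B \<inter> \<rho>). ?q b) + (\<Sum>b\<in>?B \<inter> ?J. ?q b)"
    using finB finite_subset[OF S sectors_finite[OF V]] disj by (intro sum.union_disjoint) auto
  also have "(\<Sum>b\<in>(\<Union>\<rho>\<in>S. ?B \<inter> \<rho>). ?q b) = (\<Sum>\<rho>\<in>S. \<Sum>b\<in>?B \<inter> \<rho>. ?q b)"
  proof (rule sum.UNION_disjoint)
    show "finite S"
      using finite_subset[OF S sectors_finite[OF V]] .
    show "\<forall>\<rho>\<in>S. \<forall>\<rho>'\<in>S. \<rho> \<noteq> \<rho>' \<longrightarrow> ?B \<inter> \<rho> \<inter> (?B \<inter> \<rho>') = {}"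
    proof (intro ballI impI, rule equals0I)
      fix \<rho> \<rho>' b assume \<rho>: "\<rho> \<in> S" "\<rho>' \<in> S" "\<rho> \<noteq> \<rho>'" and b: "b \<in> ?B \<inter> \<rho> \<inter> (?B \<inter> \<rho>')"
      then have "cinner b b = 0"
        using S by (intro orthogonal_family_orthogonal[OF fam, of \<rho> \<rho>']) auto
      moreover have "cinner b b = 1"
        using orthonormal_basis_cinner[OF B] b by simp
      ultimately show False
        by simp
    qed
  qed (use finB in auto)
  finally have "(\<Sum>b\<in>?B. ?q b) = (\<Sum>\<rho>\<in>S. block_logdet R \<rho>) + block_logdet R ?J"
    by (simp add: block_logdet_eigenbasis[OF R eb(1)] block_logdet_eigenbasis[OF R eb(2)])
  then show ?thesis
    unfolding excess_rate_def Inf_coding_rate[OF R] coding_rate_eq[OF unit]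
    by (simp add: diff_divide_distrib)
qed

text \<open>A realizing transform exists, and the value found for its excess rate involves only
  \<open>R\<close>, \<open>S\<close> and the sectors, so the description operator is
  well-defined.\<close>

lemma Delta_R_eq:
  assumes "unitary_rep G V" "pos_def R" "S \<subseteq> sectors G V"
  shows "Delta_R G V \<kappa> R S =
    ((\<Sum>\<rho>\<in>S. block_logdet R \<rho>) + block_logdet R (joint_space (sectors G V - S))
      - ln (Re (det R))) / 2"
  unfolding Delta_R_def
proof (rule the_equality)
  obtain U where "realizes G V R S U"
    using realizes_exists[OF assms] .
  then show "\<exists>U. realizes G V R S U \<and>
      ((\<Sum>\<rho>\<in>S. block_logdet R \<rho>) + block_logdet R (joint_space (sectors G V - S))
        - ln (Re (det R))) / 2 = excess_rate \<kappa> R U"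
    using realizes_excess_rate[OF assms] by metis
qed (use realizes_excess_rate[OF assms] in blast)

section \<open>Second moments of Gaussian vectors\<close>

lemma gaussian_vector_square_integrable_inner:
  assumes X: "gaussian_vector M X"
  shows "integrable M (\<lambda>\<omega>. (inner v (X \<omega>))\<^sup>2)"
proof -
  interpret prob_space M
    using X by (simp add: gaussian_vector_def)
  have [measurable]: "X \<in> borel_measurable M"
    using X by (simp add: gaussian_vector_def)
  obtain \<mu> where "(AE \<omega> in M. inner v (X \<omega>) = \<mu>) \<or>
      (\<exists>\<sigma>>0. distributed M lborel (\<lambda>\<omega>. inner v (X \<omega>)) (normal_density \<mu> \<sigma>))"
    using X unfolding gaussian_vector_def by blast
  then show ?thesis
  proof
    assume "AE \<omega> in M. inner v (X \<omega>) = \<mu>"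
    then have "AE \<omega> in M. (inner v (X \<omega>))\<^sup>2 = \<mu>\<^sup>2"
      by auto
    then show ?thesis
      by (subst integrable_cong_AE[where g = "\<lambda>_. \<mu>\<^sup>2"]) auto
  next
    assume "\<exists>\<sigma>>0. distributed M lborel (\<lambda>\<omega>. inner v (X \<omega>)) (normal_density \<mu> \<sigma>)"
    then obtain \<sigma> where \<sigma>: "0 < \<sigma>"
        "distributed M lborel (\<lambda>\<omega>. inner v (X \<omega>)) (normal_density \<mu> \<sigma>)"
      by blast
    \<comment> \<open>Expansion of the square around the mean, which leaves central moments of order
      2 and 1 and the density itself.\<close>
    have "integrable lborel (\<lambda>x. normal_density \<mu> \<sigma> x * (x - \<mu>)\<^sup>2
        + 2 * \<mu> * (normal_density \<mu> \<sigma> x * (x - \<mu>) ^ 1) + \<mu>\<^sup>2 * normal_density \<mu> \<sigma> x)"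
      using \<sigma>(1) by (intro Bochner_Integration.integrable_add integrable_mult_right integrable_normal_moment
        integrable_normal_density)
    also have "(\<lambda>x. normal_density \<mu> \<sigma> x * (x - \<mu>)\<^sup>2
        + 2 * \<mu> * (normal_density \<mu> \<sigma> x * (x - \<mu>) ^ 1) + \<mu>\<^sup>2 * normal_density \<mu> \<sigma> x)
      = (\<lambda>x. normal_density \<mu> \<sigma> x * x\<^sup>2)"
      by (rule ext) (simp add: algebra_simps power2_eq_square)
    finally show ?thesis
      using distributed_integrable[OF \<sigma>(2), of "\<lambda>x. x\<^sup>2"] by simp
  qed
qed

lemma gaussian_vector_norm_square_integrable:
  assumes X: "gaussian_vector M X"
  shows "integrable M (\<lambda>\<omega>. (norm (X \<omega>))\<^sup>2)"
proof -
  have "(norm (X \<omega>))\<^sup>2 = (\<Sum>b\<in>Basis. (inner b (X \<omega>))\<^sup>2)" for \<omega>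
    unfolding power2_norm_eq_inner by (subst euclidean_inner) (simp add: power2_eq_square inner_commute)
  then show ?thesis
    using gaussian_vector_square_integrable_inner[OF X] by simp
qed

lemma gaussian_vector_integrable:
  assumes X: "gaussian_vector M X"
  shows "integrable M X"
proof -
  interpret prob_space M
    using X by (simp add: gaussian_vector_def)
  \<comment> \<open>An integrable bound for the norm itself; the constant 1 is integrable as
    \<open>M\<close> is a probability space.\<close>
  have "integrable M (\<lambda>\<omega>. 1 + (norm (X \<omega>))\<^sup>2)"
    using gaussian_vector_norm_square_integrable[OF X] by simp
  then show ?thesis
  proof (rule Bochner_Integration.integrable_bound)
    show "X \<in> borel_measurable M"
      using X by (simp add: gaussian_vector_def)
    have "norm x \<le> norm (1 + (norm x)\<^sup>2)" for x :: "complex ^ 'n"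
    proof -
      have "0 \<le> (norm x - 1)\<^sup>2"
        by simp
      then have "2 * norm x \<le> 1 + (norm x)\<^sup>2"
        by (simp add: power2_eq_square algebra_simps)
      then have "norm x \<le> 1 + (norm x)\<^sup>2"
        using norm_ge_zero[of x] by linarith
      then show ?thesis
        by simp
    qed
    then show "AE \<omega> in M. norm (X \<omega>) \<le> norm (1 + (norm (X \<omega>))\<^sup>2)"
      by (intro AE_I2)
  qed
qed

lemma gaussian_vector_product_integrable:
  fixes X :: "'a \<Rightarrow> complex ^ 'n"
  assumes X: "gaussian_vector M X"
  shows "integrable M (\<lambda>\<omega>. X \<omega> $ k * cnj (X \<omega> $ l))"
  using gaussian_vector_norm_square_integrable[OF X]
proof (rule Bochner_Integration.integrable_bound)
  have [measurable]: "X \<in> borel_measurable M"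
    using X by (simp add: gaussian_vector_def)
  have "(\<lambda>x :: complex ^ 'n. x $ k * cnj (x $ l)) \<in> borel_measurable borel"
    by (intro borel_measurable_continuous_onI continuous_intros)
  then show "(\<lambda>\<omega>. X \<omega> $ k * cnj (X \<omega> $ l)) \<in> borel_measurable M"
    by measurable
  have "norm (x $ k * cnj (x $ l)) \<le> norm ((norm x)\<^sup>2)" for x :: "complex ^ 'n"
    using mult_mono[OF Finite_Cartesian_Product.norm_nth_le[of x k] Finite_Cartesian_Product.norm_nth_le[of x l]]
    by (simp add: norm_mult power2_eq_square)
  then show "AE \<omega> in M. norm (X \<omega> $ k * cnj (X \<omega> $ l)) \<le> norm ((norm (X \<omega>))\<^sup>2)"
    by simp
qed

text \<open>\<open>covariance\<close> subtracts the mean, so the image must first be shown to have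
  mean 0. Integrability of the coordinate products then lets the integral pass through the double
  sum of the matrix products.\<close>

lemma covariance_matrix_image:
  fixes X :: "'a \<Rightarrow> complex ^ 'n" and P :: "complex ^ 'n ^ 'n"
  assumes X: "gaussian_vector M X" "(LINT \<omega>|M. X \<omega>) = 0"
  shows "covariance M (\<lambda>\<omega>. P *v X \<omega>) = P ** covariance M X ** conj_transpose P"
proof -
  have "linear ((*v) P)"
    by (rule linearI) (simp_all add: vec.add matrix_vector_scaleR)
  then have "bounded_linear ((*v) P)"
    by (simp add: linear_conv_bounded_linear)
  then have mean: "(LINT \<omega>|M. P *v X \<omega>) = 0"
    using integral_bounded_linear[OF _ gaussian_vector_integrable[OF X(1)], of "(*v) P"] X(2) by simp
  note int = gaussian_vector_product_integrable[OF X(1)]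
  have cov: "covariance M X $ k $ l = (LINT \<omega>|M. X \<omega> $ k * cnj (X \<omega> $ l))" for k l
    by (simp add: covariance_def X(2))
  have "covariance M (\<lambda>\<omega>. P *v X \<omega>) $ i $ j = (P ** covariance M X ** conj_transpose P) $ i $ j" for i j
  proof -
    have "covariance M (\<lambda>\<omega>. P *v X \<omega>) $ i $ j =
        (LINT \<omega>|M. (\<Sum>k\<in>UNIV. \<Sum>l\<in>UNIV. P $ i $ k * cnj (P $ j $ l) * (X \<omega> $ k * cnj (X \<omega> $ l))))"
      by (simp add: covariance_def mean) (simp add: matrix_vector_mult_def sum_product mult_ac)
    also have "\<dots> = (\<Sum>k\<in>UNIV. \<Sum>l\<in>UNIV. P $ i $ k * cnj (P $ j $ l) * covariance M X $ k $ l)"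
      unfolding cov by (simp add: int)
    also have "\<dots> = (P ** covariance M X ** conj_transpose P) $ i $ j"
      by (subst sum.swap)
        (simp add: matrix_matrix_mult_def conj_transpose_def sum_distrib_left sum_distrib_right mult_ac)
    finally show ?thesis .
  qed
  then show ?thesis
    by (simp add: vec_eq_iff)
qed

lemma sector_entropy_eq:
  fixes X :: "'a \<Rightarrow> complex ^ 'n"
  assumes R: "pos_def R" and X: "gaussian_vector M X" "(LINT \<omega>|M. X \<omega>) = 0" "covariance M X = R"
    and T: "finite T" "orthogonal_family T"
  shows "sector_entropy M X T =
    (block_logdet R (joint_space T) + vec.dim (joint_space T) * ln (2 * pi * exp 1)) / 2"
proof -
  have "(\<Sum>\<rho>\<in>T. proj \<rho> *v X \<omega>) = proj (joint_space T) *v X \<omega>" for \<omega>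
    unfolding joint_proj_eq[OF T, symmetric] joint_proj_def using T(1)
    by (induction T rule: finite_induct) (simp_all add: matrix_vector_mult_add_rdistrib)
  then have "covariance M (\<lambda>\<omega>. \<Sum>\<rho>\<in>T. proj \<rho> *v X \<omega>) = compression R (joint_space T)"
    using covariance_matrix_image[OF X(1,2), of "proj (joint_space T)"] X(3)
    by (simp add: proj_hermitian[OF joint_space_subspace] compression_def)
  then show ?thesis
    using ln_det_on_scaled_compression[OF R joint_space_subspace, of "2 * pi * exp 1" T]
    by (simp add: sector_entropy_def entropy_on_def)
qed

theorem theorem4p11:
  fixes G :: "('g, 'b) monoid_scheme"
    and V :: "'g \<Rightarrow> complex ^ 'n ^ 'n"
    and R :: "complex ^ 'n ^ 'n"
    and M :: "'a measure"
    and X :: "'a \<Rightarrow> complex ^ 'n"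
    and c :: "(complex ^ 'n) set \<Rightarrow> real"
    and lam \<kappa> :: real
  assumes rep: "unitary_rep G V"
    and R: "pos_def R"
    and cost: "\<And>\<rho>. \<rho> \<in> sectors G V \<Longrightarrow> 0 < c \<rho>"
    and X: "gaussian_vector M X" "(LINT \<omega>|M. X \<omega>) = 0" "covariance M X = R"
    and S: "S \<subseteq> sectors G V"
  shows "Delta_R G V \<kappa> R S =
           ((\<Sum>\<rho>\<in>S. ln (Re (det_on \<rho> (sector_block R \<rho>))))
             + ln (Re (det_on (joint_space (sectors G V - S)) (joint_block R (sectors G V - S))))
             - ln (Re (det R))) / 2
       \<and> Delta_R G V \<kappa> R S = multi_information M X (separating_partition G V S)
       \<and> (\<forall>\<rho> \<in> sectors G V - S.
            let I = sector_mutual_information M X {\<rho>} (sectors G V - S - {\<rho>}) in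
              Delta_R G V \<kappa> R (insert \<rho> S) - Delta_R G V \<kappa> R S = I
            \<and> (lagrangian G V \<kappa> R c lam (insert \<rho> S) < lagrangian G V \<kappa> R c lam S
                 \<longleftrightarrow> I < lam * c \<rho>)
            \<and> (I = lam * c \<rho> \<longrightarrow>
                 lagrangian G V \<kappa> R c lam (insert \<rho> S) = lagrangian G V \<kappa> R c lam S))"
proof -
  define \<Sigma> where "\<Sigma> = sectors G V"
  define T where "T = \<Sigma> - S"
  \<comment> \<open>The entropy contribution of one dimension, beside the log-determinant and up to
    the common factor 1/2.\<close>
  define K where "K = ln (2 * pi * exp 1)"
  have fam: "orthogonal_family \<Sigma>"
    unfolding \<Sigma>_def by (rule sectors_orthogonal_family[OF rep])
  have fin: "finite \<Sigma>"
    unfolding \<Sigma>_def by (rule sectors_finite[OF rep])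
  have S': "S \<subseteq> \<Sigma>" "T \<subseteq> \<Sigma>" "S \<inter> T = {}" "S \<union> T = \<Sigma>"
    using S by (auto simp: \<Sigma>_def T_def)
  have finT: "finite T'" "orthogonal_family T'" if "T' \<subseteq> \<Sigma>" for T'
    using that fin fam finite_subset orthogonal_family_subset by blast+
  have single: "joint_space {\<rho>} = \<rho>" if "\<rho> \<in> \<Sigma>" for \<rho>
    using that fam by (simp add: joint_space_singleton orthogonal_family_subspace)
  have h: "sector_entropy M X T' = (block_logdet R (joint_space T') + vec.dim (joint_space T') * K) / 2"
    if "T' \<subseteq> \<Sigma>" for T'
    unfolding K_def by (rule sector_entropy_eq[OF R X finT[OF that]])
  have h1: "sector_entropy M X {\<rho>} = (block_logdet R \<rho> + vec.dim \<rho> * K) / 2" if "\<rho> \<in> \<Sigma>" for \<rho>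
    using h[of "{\<rho>}"] that by (simp add: single)
  have \<Delta>: "Delta_R G V \<kappa> R S' =
      ((\<Sum>\<rho>\<in>S'. block_logdet R \<rho>) + block_logdet R (joint_space (\<Sigma> - S')) - ln (Re (det R))) / 2"
    if "S' \<subseteq> \<Sigma>" for S'
    using Delta_R_eq[OF rep R] that by (simp add: \<Sigma>_def)
  have formula: "Delta_R G V \<kappa> R S =
      ((\<Sum>\<rho>\<in>S. ln (Re (det_on \<rho> (sector_block R \<rho>))))
        + ln (Re (det_on (joint_space T) (joint_block R T))) - ln (Re (det R))) / 2"
    using \<Delta>[OF S'(1)] joint_block_eq[OF finT[OF S'(2)]]
    by (simp add: block_logdet_def sector_block_def compression_def flip: T_def)

  have "vec.dim (joint_space \<Sigma>) = vec.dim (joint_space S) + vec.dim (joint_space T)"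
    using dim_joint_space_Un[OF fam S'(1,2,3)] S'(4) by simp
  \<comment> \<open>The two sides count the multiples of \<open>K\<close> in
    \<open>entropy_on M UNIV X\<close> and in the block entropies; their equality removes
    \<open>K\<close> from the multi-information.\<close>
  then have dims: "CARD('n) = (\<Sum>\<rho>\<in>S. vec.dim \<rho>) + vec.dim (joint_space T)"
    using dim_joint_space[OF finT[OF S'(1)]] joint_space_sectors[OF rep]
    by (simp add: \<Sigma>_def card_cart_basis)
  have hX: "entropy_on M UNIV X = (ln (Re (det R)) + CARD('n) * K) / 2"
    using ln_det_on_scaled_compression[OF R vec.subspace_UNIV, of "2 * pi * exp 1"]
    by (simp add: entropy_on_def X(3) K_def compression_UNIV block_logdet_def det_on_UNIV
        pos_def_hermitian[OF R] card_cart_basis)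
  let ?Q = "(\<lambda>\<rho>. {\<rho>}) ` S"
  \<comment> \<open>\<open>separating_partition\<close> drops an empty complement. As its entropy is
    0, \<open>T\<close> may be kept as a block in every case.\<close>
  have "sector_entropy M X {} = 0"
    using h[of "{}"] by (simp add: joint_space_empty block_logdet_zero[OF R])
  then have "(\<Sum>T'\<in>separating_partition G V S. sector_entropy M X T') =
      (\<Sum>T'\<in>insert T ?Q. sector_entropy M X T')"
    unfolding separating_partition_def using finT(1)[OF S'(1)]
    by (intro sum.mono_neutral_left) (auto simp: T_def \<Sigma>_def)
  also have "\<dots> = sector_entropy M X T + (\<Sum>T'\<in>?Q. sector_entropy M X T')"
    \<comment> \<open>\<open>T\<close> is none of the singletons \<open>{\<rho>}\<close> with
      \<open>\<rho>\<close> in \<open>S\<close>, since \<open>S\<close> and \<open>T\<close> are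
      disjoint.\<close>
    using finT(1)[OF S'(1)] S'(3) by (intro sum.insert) auto
  also have "(\<Sum>T'\<in>?Q. sector_entropy M X T') = (\<Sum>\<rho>\<in>S. sector_entropy M X {\<rho>})"
    by (simp add: sum.reindex)
  also have "\<dots> = (\<Sum>\<rho>\<in>S. (block_logdet R \<rho> + vec.dim \<rho> * K) / 2)"
    using S'(1) by (intro sum.cong) (auto simp: h1)
  also have "\<dots> = ((\<Sum>\<rho>\<in>S. block_logdet R \<rho>) + (\<Sum>\<rho>\<in>S. vec.dim \<rho>) * K) / 2"
    by (simp add: sum.distrib sum_distrib_right flip: sum_divide_distrib)
  finally have multi: "Delta_R G V \<kappa> R S = multi_information M X (separating_partition G V S)"
    unfolding multi_information_def hX dims \<Delta>[OF S'(1)] h[OF S'(2)] T_def[symmetric]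
    by (simp add: field_simps)

  \<comment> \<open>Together these say that the Lagrangian changes by the mutual information minus
    \<open>lam * c \<rho>\<close>, whose sign decides both comparisons.\<close>
  have step: "Delta_R G V \<kappa> R (insert \<rho> S) - Delta_R G V \<kappa> R S = sector_mutual_information M X {\<rho>} (T - {\<rho>})"
    "lagrangian G V \<kappa> R c lam (insert \<rho> S) - lagrangian G V \<kappa> R c lam S =
       Delta_R G V \<kappa> R (insert \<rho> S) - Delta_R G V \<kappa> R S - lam * c \<rho>" if \<rho>: "\<rho> \<in> T" for \<rho>
  proof -
    have \<rho>': "\<rho> \<in> \<Sigma>" "\<rho> \<notin> S"
      using \<rho> by (auto simp: T_def)
    have T: "T = {\<rho>} \<union> (T - {\<rho>})" "\<Sigma> - insert \<rho> S = T - {\<rho>}" "T - {\<rho>} \<subseteq> \<Sigma>"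
      using \<rho> by (auto simp: T_def)
    \<comment> \<open>The corresponding balance of dimensions, by which \<open>K\<close> drops out
      of the mutual information.\<close>
    have "vec.dim (joint_space T) = vec.dim \<rho> + vec.dim (joint_space (T - {\<rho>}))"
      using dim_joint_space_Un[OF fam, of "{\<rho>}" "T - {\<rho>}"] \<rho>' T single by auto
    then show "Delta_R G V \<kappa> R (insert \<rho> S) - Delta_R G V \<kappa> R S = sector_mutual_information M X {\<rho>} (T - {\<rho>})"
      using \<Delta>[of "insert \<rho> S"] \<Delta>[OF S'(1)] h[OF T(3)] h1[OF \<rho>'(1)] h[OF S'(2)] S'(1) \<rho>' finT(1)[OF S'(1)]
      by (simp add: sector_mutual_information_def T(2) insert_absorb[OF \<rho>] field_simps flip: T_def)
    have "(\<Sum>\<rho>\<in>T. c \<rho>) = c \<rho> + (\<Sum>\<rho>\<in>T - {\<rho>}. c \<rho>)"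
      using finT(1)[OF S'(2)] \<rho> by (rule sum.remove)
    then show "lagrangian G V \<kappa> R c lam (insert \<rho> S) - lagrangian G V \<kappa> R c lam S =
        Delta_R G V \<kappa> R (insert \<rho> S) - Delta_R G V \<kappa> R S - lam * c \<rho>"
      unfolding lagrangian_def \<Sigma>_def[symmetric] T(2) T_def[symmetric] by (simp add: algebra_simps)
  qed
  have "Delta_R G V \<kappa> R (insert \<rho> S) - Delta_R G V \<kappa> R S = sector_mutual_information M X {\<rho>} (T - {\<rho>})
      \<and> (lagrangian G V \<kappa> R c lam (insert \<rho> S) < lagrangian G V \<kappa> R c lam S
           \<longleftrightarrow> sector_mutual_information M X {\<rho>} (T - {\<rho>}) < lam * c \<rho>)
      \<and> (sector_mutual_information M X {\<rho>} (T - {\<rho>}) = lam * c \<rho>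
           \<longrightarrow> lagrangian G V \<kappa> R c lam (insert \<rho> S) = lagrangian G V \<kappa> R c lam S)"
    if "\<rho> \<in> T" for \<rho>
    using step[OF that] by linarith
  then show ?thesis
    unfolding \<Sigma>_def[symmetric] T_def[symmetric] Let_def
    using formula multi by blast
qed

end
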